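(* Let $\Sigma$ be the discrete-time linear time-invariant system $x(t+1)=Ax(t)+Bu(t)+Ed(t)$, $y(t)=Cx(t)+Du(t)+Fd(t)$, $t\in\mathbb{Z}_+$, with $x(t)\in\mathbb{R}^n$, $u(t)\in\mathbb{R}^m$, $y(t)\in\mathbb{R}^p$, $d(t)\in\mathbb{R}^r$, real matrices $A,B,C,D,E,F$, and $\begin{bmatrix} E \\ F \end{bmatrix}\in\mathbb{R}^{(n+p)\times r}$ of full column rank $r$. Let $\begin{bmatrix} M_E & M_F \end{bmatrix}\in\mathbb{R}^{(n+p-r)\times(n+p)}$ (with $M_E$ having $n$ columns and $M_F$ having $p$ columns) be a full row rank matrix with $\ker\begin{bmatrix} M_E & M_F \end{bmatrix}=\mathrm{Im}\begin{bmatrix} E \\ F \end{bmatrix}$. The following facts are equivalent. (i) There exists a UIO $\hat\Sigma$ for $\Sigma$ of the form $z(t+1)=A_{UIO}z(t)+B^u_{UIO}u(t)+B^y_{UIO}y(t)$, $\hat x(t)=z(t)+D^u_{UIO}u(t)+D^y_{UIO}y(t)$, with $z(t),\hat x(t)\in\mathbb{R}^n$. (ii) There exists $T(z)=T_0+T_1z\in\mathbb{R}[z]^{n\times(n+p-r)}$ such that $$\begin{bmatrix} zI_n-A_{UIO} & -B^u_{UIO}-(zI_n-A_{UIO})D^u_{UIO} & -B^y_{UIO}-(zI_n-A_{UIO})D^y_{UIO} \end{bmatrix}=T(z)\begin{bmatrix} M_E & M_F \end{bmatrix}\begin{bmatrix} zI_n-A & -B & 0 \\ -C & -D & I_p \end{bmatrix}$$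 for some real matrices $A_{UIO},B^u_{UIO},B^y_{UIO},D^u_{UIO},D^y_{UIO}$ with $A_{UIO}$ Schur stable. (iii) There exists $T(z)=T_0+T_1z\in\mathbb{R}[z]^{n\times(n+p-r)}$ such that $$T(z)\begin{bmatrix} M_E & M_F \end{bmatrix}\begin{bmatrix} zI_n-A \\ -C \end{bmatrix}=zI_n-A_{UIO}$$ for some Schur stable matrix $A_{UIO}$. (iv) There exists $S(z)=S_0+S_1z\in\mathbb{R}[z]^{n\times(n+p)}$ such that $$S(z)\begin{bmatrix} zI_n-A & -E \\ -C & -F \end{bmatrix}=\begin{bmatrix} zI_n-A_{UIO} & 0 \end{bmatrix}$$ for some Schur stable matrix $A_{UIO}$. (v) There exist real matrices $A_{UIO},B^u_{UIO},B^y_{UIO},D^u_{UIO},D^y_{UIO}$, with $A_{UIO}$ Schur stable, satisfying $$\begin{bmatrix} -D^y_{UIO} & A_{UIO}D^y_{UIO}-B^y_{UIO} \end{bmatrix}\begin{bmatrix} CE & F \\ F & 0 \end{bmatrix}=\begin{bmatrix} -E & 0 \end{bmatrix},$$ $$A_{UIO}=A+\begin{bmatrix} -D^y_{UIO} & A_{UIO}D^y_{UIO}-B^y_{UIO} \end{bmatrix}\begin{bmatrix} CA \\ C \end{bmatrix},$$ $$\begin{bmatrix} B^u_{UIO} \\ D^u_{UIO} \end{bmatrix}=\begin{bmatrix} I_n-D^y_{UIO}C & -B^y_{UIO} \\ 0 & -D^y_{UIO} \end{bmatrix}\begin{bmatrix} B \\ D \end{bmatrix}.$$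
   Context: All trajectories are defined on $\mathbb{Z}_+=\{0,1,2,\dots\}$. A system $\hat\Sigma$ of the form in (i) is an acceptor for $\Sigma$ if for every trajectory $(x,u,y,d)$ satisfying $\Sigma$ there exists a trajectory $z$ such that $(\hat x=x,u,y,z)$ satisfies the equations of $\hat\Sigma$. $\hat\Sigma$ is an unknown-input observer (UIO) for $\Sigma$ if it is an acceptor and, when $\hat\Sigma$ is driven by the input $u$ and output $y$ of $\Sigma$, the error $e(t)=x(t)-\hat x(t)$ tends to $0$ as $t\to+\infty$ for every $x(0)$, $z(0)$, every input $u$ and every unknown input $d$. $\mathbb{R}[z]$ is the ring of real polynomials in the indeterminate $z$; $T_0,T_1,S_0,S_1$ are real matrices, and equalities involving the indeterminate $z$ are equalities of polynomial matrices. A real square matrix is Schur stable if all its eigenvalues have modulus less than $1$. *)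

theory Defs
  imports
    Complex_Main
    "Jordan_Normal_Form.Char_Poly"
    "Jordan_Normal_Form.Matrix_Kernel"
    "Jordan_Normal_Form.DL_Rank"
begin

text \<open>Matrices and vectors have explicit dimensions (\<open>carrier_mat\<close>, \<open>carrier_vec\<close>), so every
  dimension, including \<open>0\<close>, is allowed.  Time is \<open>nat\<close>.\<close>

definition append_cols :: "'a :: zero mat \<Rightarrow> 'a mat \<Rightarrow> 'a mat" (infixr \<open>@\<^sub>c\<close> 65) where
  "A @\<^sub>c B = four_block_mat A B (0\<^sub>m 0 (dim_col A)) (0\<^sub>m 0 (dim_col B))"

definition schur_stable :: "real mat \<Rightarrow> bool" where
  "schur_stable A \<longleftrightarrow> square_mat A \<and>
     (\<forall>l. eigenvalue (map_mat complex_of_real A) l \<longrightarrow> cmod l < 1)"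

text \<open>Real matrices as constant polynomial matrices, and \<open>T\<^sub>0 + T\<^sub>1 z\<close>, where the indeterminate
  \<open>z\<close> is \<open>[:0, 1:]\<close>.  The matrix \<open>z I - A\<close> is the library's \<open>char_poly_matrix A\<close>.\<close>

definition const_pmat :: "real mat \<Rightarrow> real poly mat" where
  "const_pmat A = map_mat (\<lambda>a. [:a:]) A"

definition pencil :: "real mat \<Rightarrow> real mat \<Rightarrow> real poly mat" where
  "pencil T0 T1 = const_pmat T0 + [:0, 1:] \<cdot>\<^sub>m const_pmat T1"

definition sys_trajectory ::
  "real mat \<Rightarrow> real mat \<Rightarrow> real mat \<Rightarrow> real mat \<Rightarrow> real mat \<Rightarrow> real mat \<Rightarrow>
   (nat \<Rightarrow> real vec) \<Rightarrow> (nat \<Rightarrow> real vec) \<Rightarrow> (nat \<Rightarrow> real vec) \<Rightarrow> (nat \<Rightarrow> real vec) \<Rightarrow> bool" where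
  "sys_trajectory A B C D E F x u y d \<longleftrightarrow>
     (\<forall>t. x t \<in> carrier_vec (dim_row A) \<and> u t \<in> carrier_vec (dim_col B) \<and>
          y t \<in> carrier_vec (dim_row C) \<and> d t \<in> carrier_vec (dim_col E) \<and>
          x (Suc t) = A *\<^sub>v x t + B *\<^sub>v u t + E *\<^sub>v d t \<and>
          y t = C *\<^sub>v x t + D *\<^sub>v u t + F *\<^sub>v d t)"

definition obs_trajectory ::
  "real mat \<Rightarrow> real mat \<Rightarrow> real mat \<Rightarrow> real mat \<Rightarrow> real mat \<Rightarrow>
   (nat \<Rightarrow> real vec) \<Rightarrow> (nat \<Rightarrow> real vec) \<Rightarrow> (nat \<Rightarrow> real vec) \<Rightarrow> (nat \<Rightarrow> real vec) \<Rightarrow> bool" where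
  "obs_trajectory Ao Bu By Du Dy xh u y z \<longleftrightarrow>
     (\<forall>t. xh t \<in> carrier_vec (dim_row Ao) \<and> u t \<in> carrier_vec (dim_col Bu) \<and>
          y t \<in> carrier_vec (dim_col By) \<and> z t \<in> carrier_vec (dim_row Ao) \<and>
          z (Suc t) = Ao *\<^sub>v z t + Bu *\<^sub>v u t + By *\<^sub>v y t \<and>
          xh t = z t + Du *\<^sub>v u t + Dy *\<^sub>v y t)"

definition is_acceptor ::
  "real mat \<Rightarrow> real mat \<Rightarrow> real mat \<Rightarrow> real mat \<Rightarrow> real mat \<Rightarrow> real mat \<Rightarrow>
   real mat \<Rightarrow> real mat \<Rightarrow> real mat \<Rightarrow> real mat \<Rightarrow> real mat \<Rightarrow> bool" where
  "is_acceptor A B C D E F Ao Bu By Du Dy \<longleftrightarrow>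
     (\<forall>x u y d. sys_trajectory A B C D E F x u y d \<longrightarrow>
        (\<exists>z. obs_trajectory Ao Bu By Du Dy x u y z))"

text \<open>Type \<open>vec\<close> carries no topology, so convergence in \<open>\<real>\<^sup>n\<close> is stated componentwise.\<close>

definition tends_to_zero :: "(nat \<Rightarrow> real vec) \<Rightarrow> nat \<Rightarrow> bool" where
  "tends_to_zero e n \<longleftrightarrow> (\<forall>i<n. (\<lambda>t. e t $ i) \<longlonglongrightarrow> 0)"

text \<open>The quantification over all trajectories covers all initial states \<open>x 0\<close>, \<open>z 0\<close> and all
  inputs \<open>u\<close>, \<open>d\<close>, since these determine the remaining signals and are unconstrained.\<close>

definition is_uio ::
  "real mat \<Rightarrow> real mat \<Rightarrow> real mat \<Rightarrow> real mat \<Rightarrow> real mat \<Rightarrow> real mat \<Rightarrow>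
   real mat \<Rightarrow> real mat \<Rightarrow> real mat \<Rightarrow> real mat \<Rightarrow> real mat \<Rightarrow> bool" where
  "is_uio A B C D E F Ao Bu By Du Dy \<longleftrightarrow>
     is_acceptor A B C D E F Ao Bu By Du Dy \<and>
     (\<forall>x u y d xh z. sys_trajectory A B C D E F x u y d \<longrightarrow> obs_trajectory Ao Bu By Du Dy xh u y z \<longrightarrow>
        tends_to_zero (\<lambda>t. x t - xh t) (dim_row A))"

definition all_equivalent :: "bool list \<Rightarrow> bool" where
  "all_equivalent Ps \<longleftrightarrow> (\<forall>P\<in>set Ps. \<forall>Q\<in>set Ps. P \<longleftrightarrow> Q)"

end

(*
  Writing S(z) = [P(z) Q(z)] in (iv) and comparing coefficients of z forces P1 = 0 and
  P0 = I + Q1 C, so S is determined by Q0 and Q1, and the substitution Dy = -Q1,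
  By = Ao Dy - Q0 turns (iv) into the equations of (v).  These equations say exactly that
  eliminating z(t) = x(t) - Du u(t) - Dy y(t) from the observer gives an identity in x(t), u(t),
  u(t+1), d(t), d(t+1); as these vectors are arbitrary, this is the acceptor property.  For an
  acceptor the error obeys e(t+1) = Ao e(t) with e(0) arbitrary, so convergence means Schur
  stability of Ao.  Finally (iv) says that the coefficients of S annihilate [E; F], and since
  [M_E M_F] has a right inverse and kernel Im [E; F], this holds iff S = T [M_E M_F], which
  gives (iii) and, after appending the input and output columns, (ii).
*)
theory Submission
  imports Defs "Jordan_Normal_Form.Spectral_Radius"
begin

text \<open>Every implication keeps \<open>Ao\<close>, so Schur stability is passed along unchanged
  and is analysed only once, where it is exchanged for convergence of the error. The known input
  imposes no condition on solvability: \<open>Bu\<close> and \<open>Du\<close> are given explicitly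
  by the remaining matrices, which is why (iii) and (iv) can do without them. What is left of each
  pencil identity is a system of equations between real matrices, one for each of the powers 1, z,
  z^2 that can occur in a product of two pencils.\<close>

section \<open>Block matrices built by concatenation\<close>

lemma append_cols_carrier [simp]:
  assumes "A \<in> carrier_mat n a" "B \<in> carrier_mat n b"
  shows "A @\<^sub>c B \<in> carrier_mat n (a + b)"
  using assms by (auto simp: append_cols_def)

lemma append_cols_eq_iff:
  assumes "A \<in> carrier_mat n a" "A' \<in> carrier_mat n a" "B \<in> carrier_mat n b" "B' \<in> carrier_mat n b"
  shows "A @\<^sub>c B = A' @\<^sub>c B' \<longleftrightarrow> A = A' \<and> B = B'"
proof
  assume eq: "A @\<^sub>c B = A' @\<^sub>c B'"
  have "A $$ (i, j) = A' $$ (i, j)" if "i < n" "j < a" for i j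
    using arg_cong[OF eq, of "\<lambda>M. M $$ (i, j)"] assms that by (auto simp: append_cols_def)
  moreover have "B $$ (i, j) = B' $$ (i, j)" if "i < n" "j < b" for i j
    using arg_cong[OF eq, of "\<lambda>M. M $$ (i, j + a)"] assms that by (auto simp: append_cols_def)
  ultimately show "A = A' \<and> B = B'"
    using assms by (auto intro!: eq_matI)
qed simp

lemma append_rows_eq_iff:
  assumes "A \<in> carrier_mat a n" "A' \<in> carrier_mat a n" "B \<in> carrier_mat b n" "B' \<in> carrier_mat b n"
  shows "A @\<^sub>r B = A' @\<^sub>r B' \<longleftrightarrow> A = A' \<and> B = B'"
proof
  assume eq: "A @\<^sub>r B = A' @\<^sub>r B'"
  have "A $$ (i, j) = A' $$ (i, j)" if "i < a" "j < n" for i j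
    using arg_cong[OF eq, of "\<lambda>M. M $$ (i, j)"] assms that by (auto simp: append_rows_def)
  moreover have "B $$ (i, j) = B' $$ (i, j)" if "i < b" "j < n" for i j
    using arg_cong[OF eq, of "\<lambda>M. M $$ (i + a, j)"] assms that by (auto simp: append_rows_def)
  ultimately show "A = A' \<and> B = B'"
    using assms by (auto intro!: eq_matI)
qed simp

lemma split_append_cols:
  assumes "S \<in> carrier_mat n (a + b)"
  obtains P Q where "P \<in> carrier_mat n a" "Q \<in> carrier_mat n b" "S = P @\<^sub>c Q"
proof
  show "S = mat n a (\<lambda>(i, j). S $$ (i, j)) @\<^sub>c mat n b (\<lambda>(i, j). S $$ (i, j + a))"
    using assms by (intro eq_matI) (auto simp: append_cols_def)
qed auto

lemma four_block_mat_eq_append: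
  assumes "A \<in> carrier_mat n1 m1" "B \<in> carrier_mat n1 m2" "C \<in> carrier_mat n2 m1" "D \<in> carrier_mat n2 m2"
  shows "four_block_mat A B C D = (A @\<^sub>r C) @\<^sub>c (B @\<^sub>r D)"
    and "four_block_mat A B C D = (A @\<^sub>c B) @\<^sub>r (C @\<^sub>c D)"
  using assms by (auto intro!: eq_matI simp: append_cols_def append_rows_def)

lemma append_rows_append_cols:
  assumes "A \<in> carrier_mat n1 m1" "B \<in> carrier_mat n1 m2" "C \<in> carrier_mat n2 m1" "D \<in> carrier_mat n2 m2"
  shows "(A @\<^sub>c B) @\<^sub>r (C @\<^sub>c D) = (A @\<^sub>r C) @\<^sub>c (B @\<^sub>r D)"
  using four_block_mat_eq_append[OF assms] by simp

lemma append_cols_mult_append_rows: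
  fixes P :: "'a :: comm_ring_1 mat"
  assumes "P \<in> carrier_mat n a" "Q \<in> carrier_mat n b" "X \<in> carrier_mat a c" "Y \<in> carrier_mat b c"
  shows "(P @\<^sub>c Q) * (X @\<^sub>r Y) = P * X + Q * Y"
proof -
  \<comment> \<open>Both concatenations are four-block matrices with empty blocks, below for columns
    and on the right for rows, so the general block product applies and the empty blocks contribute
    nothing.\<close>
  have "(P @\<^sub>c Q) * (X @\<^sub>r Y) = four_block_mat (P * X + Q * Y) (P * 0\<^sub>m a 0 + Q * 0\<^sub>m b 0)
     (0\<^sub>m 0 a * X + 0\<^sub>m 0 b * Y) (0\<^sub>m 0 a * 0\<^sub>m a 0 + 0\<^sub>m 0 b * 0\<^sub>m b 0)"
    unfolding append_cols_def append_rows_def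
    using assms by (subst mult_four_block_mat[of _ n a _ b _ 0 _ _ c _ 0]) auto
  also have "\<dots> = P * X + Q * Y"
    using assms by (intro eq_matI) auto
  finally show ?thesis .
qed

lemma mult_append_cols:
  fixes S :: "'a :: comm_ring_1 mat"
  assumes "S \<in> carrier_mat n k" "X \<in> carrier_mat k a" "Y \<in> carrier_mat k b"
  shows "S * (X @\<^sub>c Y) = (S * X) @\<^sub>c (S * Y)"
proof (rule eq_matI)
  fix i j assume ij: "i < dim_row ((S * X) @\<^sub>c (S * Y))" "j < dim_col ((S * X) @\<^sub>c (S * Y))"
  have "col (X @\<^sub>c Y) j = (if j < a then col X j else col Y (j - a))"
    using assms ij by (intro eq_vecI) (auto simp: append_cols_def)
  then show "(S * (X @\<^sub>c Y)) $$ (i, j) = ((S * X) @\<^sub>c (S * Y)) $$ (i, j)"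
    using assms ij by (auto simp: append_cols_def)
qed (use assms in \<open>auto simp: append_cols_def\<close>)

lemma append_rows_mult:
  fixes S :: "'a :: comm_ring_1 mat"
  assumes "S \<in> carrier_mat k n" "X \<in> carrier_mat a k" "Y \<in> carrier_mat b k"
  shows "(X @\<^sub>r Y) * S = (X * S) @\<^sub>r (Y * S)"
proof (rule eq_matI)
  fix i j assume ij: "i < dim_row ((X * S) @\<^sub>r (Y * S))" "j < dim_col ((X * S) @\<^sub>r (Y * S))"
  have "row (X @\<^sub>r Y) i = (if i < a then row X i else row Y (i - a))"
    using assms ij by (intro eq_vecI) (auto simp: append_rows_def)
  then show "((X @\<^sub>r Y) * S) $$ (i, j) = ((X * S) @\<^sub>r (Y * S)) $$ (i, j)"
    using assms ij by (auto simp: append_rows_def)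
qed (use assms in \<open>auto simp: append_rows_def\<close>)

section \<open>Polynomial matrices of degree at most two\<close>

text \<open>A product of two pencils has degree at most two. Storing its three coefficient matrices
  turns an identity of polynomial matrices into three identities of real matrices.\<close>

definition quad_pencil :: "real mat \<Rightarrow> real mat \<Rightarrow> real mat \<Rightarrow> real poly mat" where
  "quad_pencil X0 X1 X2 =
     mat (dim_row X0) (dim_col X0) (\<lambda>ij. [:X0 $$ ij, X1 $$ ij, X2 $$ ij:])"

lemma quad_pencil_eq_iff:
  assumes "X0 \<in> carrier_mat a b" "X1 \<in> carrier_mat a b" "X2 \<in> carrier_mat a b"
    and "Y0 \<in> carrier_mat a b" "Y1 \<in> carrier_mat a b" "Y2 \<in> carrier_mat a b"
  shows "quad_pencil X0 X1 X2 = quad_pencil Y0 Y1 Y2 \<longleftrightarrow> X0 = Y0 \<and> X1 = Y1 \<and> X2 = Y2"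
proof
  assume eq: "quad_pencil X0 X1 X2 = quad_pencil Y0 Y1 Y2"
  have "X0 $$ (i, j) = Y0 $$ (i, j) \<and> X1 $$ (i, j) = Y1 $$ (i, j) \<and> X2 $$ (i, j) = Y2 $$ (i, j)"
    if "i < a" "j < b" for i j
    using arg_cong[OF eq, of "\<lambda>M. M $$ (i, j)"] assms that by (auto simp: quad_pencil_def)
  then show "X0 = Y0 \<and> X1 = Y1 \<and> X2 = Y2"
    using assms by (auto intro!: eq_matI)
qed simp

lemma const_pmat_carrier [simp]: "const_pmat X \<in> carrier_mat a b \<longleftrightarrow> X \<in> carrier_mat a b"
  by (auto simp: const_pmat_def)

lemma pencil_carrier [simp]: "X1 \<in> carrier_mat a b \<Longrightarrow> pencil X0 X1 \<in> carrier_mat a b"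
  by (auto simp: pencil_def const_pmat_def)

lemma index_pencil:
  assumes "X0 \<in> carrier_mat a b" "X1 \<in> carrier_mat a b" "i < a" "j < b"
  shows "pencil X0 X1 $$ (i, j) = [:X0 $$ (i, j), X1 $$ (i, j):]"
  using assms by (auto simp: pencil_def const_pmat_def)

lemma pencil_eq_quad:
  assumes "X0 \<in> carrier_mat a b" "X1 \<in> carrier_mat a b"
  shows "pencil X0 X1 = quad_pencil X0 X1 (0\<^sub>m a b)"
  using assms by (intro eq_matI) (auto simp: quad_pencil_def pencil_def const_pmat_def)

lemma pencil_eq_iff:
  assumes "X0 \<in> carrier_mat a b" "X1 \<in> carrier_mat a b" "Y0 \<in> carrier_mat a b" "Y1 \<in> carrier_mat a b"
  shows "pencil X0 X1 = pencil Y0 Y1 \<longleftrightarrow> X0 = Y0 \<and> X1 = Y1"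
  using assms by (simp add: pencil_eq_quad[where a = a and b = b] quad_pencil_eq_iff[where a = a and b = b])

lemma sum_quad_poly:
  "(\<Sum>k\<in>K. [:f k, g k, h k:]) = [:\<Sum>k\<in>K. f k, \<Sum>k\<in>K. g k, \<Sum>k\<in>K. h k:]"
  by (induction K rule: infinite_finite_induct) auto

lemma pencil_mult_pencil:
  assumes "U0 \<in> carrier_mat a b" "U1 \<in> carrier_mat a b" "V0 \<in> carrier_mat b c" "V1 \<in> carrier_mat b c"
  shows "pencil U0 U1 * pencil V0 V1 = quad_pencil (U0 * V0) (U0 * V1 + U1 * V0) (U1 * V1)"
proof (rule eq_matI)
  fix i j assume "i < dim_row (quad_pencil (U0 * V0) (U0 * V1 + U1 * V0) (U1 * V1))"
    "j < dim_col (quad_pencil (U0 * V0) (U0 * V1 + U1 * V0) (U1 * V1))"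
  then have ij: "i < a" "j < c" using assms by (auto simp: quad_pencil_def)
  have dims: "dim_row (pencil U0 U1) = a" "dim_col (pencil U0 U1) = b"
      "dim_row (pencil V0 V1) = b" "dim_col (pencil V0 V1) = c"
    using assms by (auto simp: pencil_def const_pmat_def)
  have "(pencil U0 U1 * pencil V0 V1) $$ (i, j)
      = (\<Sum>k\<in>{0..<b}. [:U0 $$ (i, k) * V0 $$ (k, j),
            U0 $$ (i, k) * V1 $$ (k, j) + U1 $$ (i, k) * V0 $$ (k, j), U1 $$ (i, k) * V1 $$ (k, j):])"
    using ij assms dims
    by (auto simp: scalar_prod_def index_pencil[where a = a and b = b]
        index_pencil[where a = b and b = c] algebra_simps intro!: sum.cong)
  also have "\<dots> = quad_pencil (U0 * V0) (U0 * V1 + U1 * V0) (U1 * V1) $$ (i, j)"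
    using ij assms by (simp add: sum_quad_poly quad_pencil_def scalar_prod_def sum.distrib)
  finally show "(pencil U0 U1 * pencil V0 V1) $$ (i, j)
      = quad_pencil (U0 * V0) (U0 * V1 + U1 * V0) (U1 * V1) $$ (i, j)" .
qed (use assms in \<open>auto simp: quad_pencil_def pencil_def const_pmat_def\<close>)

lemma const_pmat_eq_pencil:
  assumes "X \<in> carrier_mat a b"
  shows "const_pmat X = pencil X (0\<^sub>m a b)"
  using assms by (intro eq_matI) (auto simp: pencil_def const_pmat_def)

lemma uminus_pencil:
  assumes "X0 \<in> carrier_mat a b" "X1 \<in> carrier_mat a b"
  shows "- pencil X0 X1 = pencil (- X0) (- X1)"
  using assms by (intro eq_matI) (auto simp: pencil_def const_pmat_def)

lemma minus_pencil:
  assumes "X0 \<in> carrier_mat a b" "X1 \<in> carrier_mat a b" "Y0 \<in> carrier_mat a b" "Y1 \<in> carrier_mat a b"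
  shows "pencil X0 X1 - pencil Y0 Y1 = pencil (X0 - Y0) (X1 - Y1)"
  using assms by (intro eq_matI) (auto simp: pencil_def const_pmat_def)

lemma char_poly_matrix_eq_pencil:
  assumes "A \<in> carrier_mat n n"
  shows "char_poly_matrix A = pencil (- A) (1\<^sub>m n)"
  using assms by (intro eq_matI) (auto simp: pencil_def const_pmat_def char_poly_matrix_def)

lemma zero_eq_pencil: "0\<^sub>m a b = pencil (0\<^sub>m a b) (0\<^sub>m a b)"
  by (intro eq_matI) (auto simp: pencil_def const_pmat_def)

lemma append_rows_pencil:
  assumes "X0 \<in> carrier_mat a n" "X1 \<in> carrier_mat a n" "Y0 \<in> carrier_mat b n" "Y1 \<in> carrier_mat b n"
  shows "pencil X0 X1 @\<^sub>r pencil Y0 Y1 = pencil (X0 @\<^sub>r Y0) (X1 @\<^sub>r Y1)"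
  using assms by (intro eq_matI) (auto simp: pencil_def const_pmat_def append_rows_def)

lemma pencil_mult_const:
  assumes "U0 \<in> carrier_mat a b" "U1 \<in> carrier_mat a b" "X \<in> carrier_mat b c"
  shows "pencil U0 U1 * const_pmat X = pencil (U0 * X) (U1 * X)"
  using assms
  by (simp add: const_pmat_eq_pencil[where a = b and b = c] pencil_mult_pencil[where a = a and b = b and c = c]
      pencil_eq_quad[where a = a and b = c])

section \<open>Factorisation through a matrix of full row rank\<close>

text \<open>A maximal independent set of columns has as many elements as the rank, here
  \<open>q\<close>, and is therefore a basis. So every unit vector is \<open>M v\<close> for some
  \<open>v\<close>, and these vectors are the columns of the right inverse.\<close>

lemma full_row_rank_right_inverse:
  fixes M :: "'a :: field mat"
  assumes M: "M \<in> carrier_mat q k" and rank: "vec_space.rank q M = q"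
  obtains R where "R \<in> carrier_mat k q" "M * R = 1\<^sub>m q"
proof -
  interpret vec_space "TYPE('a)" q .
  have cols: "set (cols M) \<subseteq> carrier_vec q"
    using cols_dim M by blast
  obtain S where S: "finite S" "maximal S (\<lambda>T. T \<subseteq> set (cols M) \<and> lin_indpt T)"
    using maximal_exists_superset[of "set (cols M)" "\<lambda>T. T \<subseteq> set (cols M) \<and> lin_indpt T" "{}"]
    by (auto simp: lin_dep_def)
  then have sub: "S \<subseteq> set (cols M)" and li: "lin_indpt S"
    by (auto simp: maximal_def)
  have "card S = q"
    using rank_card_indpt[OF M S(2)] rank by simp
  then have "basis S"
    using S sub cols li by (intro dim_li_is_basis) (auto simp: dim_is_n)
  then have span: "span (set (cols M)) = carrier_vec q"
    using span_is_monotone[OF sub] span_is_subset2[OF cols] by (auto simp: basis_def)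
  have "\<exists>v \<in> carrier_vec k. M *\<^sub>v v = unit_vec q j" if "j < q" for j
  proof -
    have "unit_vec q j \<in> span (set (cols M))"
      by (simp add: span)
    then obtain c where "unit_vec q j = lincomb_list c (cols M)"
      using span_list_as_span[OF cols] in_span_listE by metis
    also have "\<dots> = M *\<^sub>v vec k c"
      using cols M by (subst lincomb_list_as_mat_mult) auto
    finally show ?thesis
      by (metis vec_carrier)
  qed
  then obtain f where f: "\<And>j. j < q \<Longrightarrow> f j \<in> carrier_vec k \<and> M *\<^sub>v f j = unit_vec q j"
    by metis
  have R: "mat_of_cols k (map f [0..<q]) \<in> carrier_mat k q"
    by auto
  have "M * mat_of_cols k (map f [0..<q]) = 1\<^sub>m q"
  proof (rule mat_col_eqI)
    fix j assume "j < dim_col (1\<^sub>m q :: 'a mat)"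
    then show "col (M * mat_of_cols k (map f [0..<q])) j = col (1\<^sub>m q) j"
      using f[of j] col_mult2[OF M R, of j] by simp
  qed (use M in auto)
  then show ?thesis
    using that[OF R] by simp
qed

text \<open>For a right inverse \<open>R\<close> of \<open>M\<close>, the matrix
  \<open>P = 1 - R M\<close> is the projection onto the kernel of \<open>M\<close> along the image
  of \<open>R\<close>. Its columns lie in the image of \<open>N\<close>, where \<open>S\<close>
  vanishes, so \<open>S P = 0\<close>, that is, \<open>S = (S R) M\<close>.\<close>

lemma mult_eq_zero_imp_factor:
  fixes M N S :: "'a :: field mat"
  assumes M: "M \<in> carrier_mat q k" and N: "N \<in> carrier_mat k r" and S: "S \<in> carrier_mat l k"
    and rank: "vec_space.rank q M = q"
    and ker: "mat_kernel M \<subseteq> {N *\<^sub>v w | w. w \<in> carrier_vec r}"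
    and SN: "S * N = 0\<^sub>m l r"
  obtains T where "T \<in> carrier_mat l q" "S = T * M"
proof -
  obtain R where R: "R \<in> carrier_mat k q" and MR: "M * R = 1\<^sub>m q"
    using full_row_rank_right_inverse[OF M rank] .
  define P where "P = 1\<^sub>m k - R * M"
  have P: "P \<in> carrier_mat k k"
    using R M by (auto simp: P_def)
  have "M * P = M - M * R * M"
    using M R by (simp add: P_def mult_minus_distrib_mat[of M q k _ k] assoc_mult_mat[of M q k R q M k])
  then have MP: "M * P = 0\<^sub>m q k"
    using M MR by (auto intro!: eq_matI)
  have "S * P = 0\<^sub>m l k"
  proof (rule mat_col_eqI)
    fix j assume "j < dim_col (0\<^sub>m l k :: 'a mat)"
    then have j: "j < k" by simp
    have "M *\<^sub>v col P j = col (M * P) j"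
      by (rule col_mult2[OF M P j, symmetric])
    also have "\<dots> = 0\<^sub>v q"
      using j by (simp add: MP)
    finally have "col P j \<in> mat_kernel M"
      using M P j by (intro mat_kernelI[of M q k]) auto
    then obtain w where w: "w \<in> carrier_vec r" "col P j = N *\<^sub>v w"
      using ker by blast
    have "col (S * P) j = S *\<^sub>v (N *\<^sub>v w)"
      unfolding col_mult2[OF S P j] w(2) ..
    also have "\<dots> = S * N *\<^sub>v w"
      using assoc_mult_mat_vec[OF S N w(1)] by simp
    also have "\<dots> = 0\<^sub>v l"
      using w by (intro eq_vecI) (auto simp: SN)
    finally show "col (S * P) j = col (0\<^sub>m l k) j"
      using j by simp
  qed (use S P in auto)
  moreover have "S * P = S - S * R * M"
    using S R M by (simp add: P_def mult_minus_distrib_mat[of S l k _ k] assoc_mult_mat[of S l k R q M k])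
  ultimately have SRM: "S - S * R * M = 0\<^sub>m l k" by simp
  have "S = S * R * M"
  proof (rule eq_matI)
    fix i j assume ij: "i < dim_row (S * R * M)" "j < dim_col (S * R * M)"
    then have "(S - S * R * M) $$ (i, j) = 0"
      using SRM S M by simp
    then show "S $$ (i, j) = (S * R * M) $$ (i, j)"
      using ij by simp
  qed (use S R M in auto)
  then show ?thesis
    using that[of "S * R"] S R by simp
qed

lemma mult_eq_zero_of_kernel:
  fixes M N :: "'a :: field mat"
  assumes M: "M \<in> carrier_mat q k" and N: "N \<in> carrier_mat k r"
    and ker: "{N *\<^sub>v w | w. w \<in> carrier_vec r} \<subseteq> mat_kernel M"
  shows "M * N = 0\<^sub>m q r"
proof (rule mat_col_eqI)
  fix j assume "j < dim_col (0\<^sub>m q r :: 'a mat)"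
  then have j: "j < r" by simp
  have "N *\<^sub>v unit_vec r j = col N j"
    using N j by (intro eq_vecI) auto
  moreover have "N *\<^sub>v unit_vec r j \<in> mat_kernel M"
    using ker unit_vec_carrier[of r j] by blast
  ultimately show "col (M * N) j = col (0\<^sub>m q r) j"
    using M j unfolding col_mult2[OF M N j] by (simp add: mat_kernel_def)
qed (use M N in auto)

section \<open>Coefficient comparison in the pencil equations\<close>

lemma minus_mat_eq_iff:
  fixes X Y Z :: "'a :: ab_group_add mat"
  assumes "X \<in> carrier_mat a b" "Y \<in> carrier_mat a b" "Z \<in> carrier_mat a b"
  shows "X - Y = Z \<longleftrightarrow> X = Z + Y"
  using carrier_matD[OF assms(1)] carrier_matD[OF assms(2)] carrier_matD[OF assms(3)]
  by (auto simp: mat_eq_iff algebra_simps)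

lemma uminus_minus_mat:
  fixes X Y :: "'a :: ab_group_add mat"
  assumes "X \<in> carrier_mat a b" "Y \<in> carrier_mat a b"
  shows "- X - Y = - (X + Y)"
  using assms by (intro eq_matI) auto

lemma uminus_mat_eq_zero_iff:
  fixes X :: "'a :: ab_group_add mat"
  shows "- X = 0\<^sub>m a b \<longleftrightarrow> X = 0\<^sub>m a b"
  by (auto simp: mat_eq_iff)

text \<open>The right factor has the leading coefficient \<open>[I; 0]\<close>, so the coefficient
  of z^2 in the product is \<open>P1\<close> alone. Once \<open>P1\<close> is zero, the coefficient
  of z no longer contains \<open>A\<close> and determines \<open>P0\<close>, and the constant term
  determines \<open>Ao\<close>.\<close>

lemma pencil_mult_state_columns:
  assumes P: "P0 \<in> carrier_mat n n" "P1 \<in> carrier_mat n n"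
    and Q: "Q0 \<in> carrier_mat n p" "Q1 \<in> carrier_mat n p"
    and A: "A \<in> carrier_mat n n" and C: "C \<in> carrier_mat p n" and Ao: "Ao \<in> carrier_mat n n"
  shows "pencil (P0 @\<^sub>c Q0) (P1 @\<^sub>c Q1) * (char_poly_matrix A @\<^sub>r - const_pmat C) = char_poly_matrix Ao
     \<longleftrightarrow> P1 = 0\<^sub>m n n \<and> P0 = 1\<^sub>m n + Q1 * C \<and> Ao = P0 * A + Q0 * C"
proof -
  have rhs: "char_poly_matrix A @\<^sub>r - const_pmat C = pencil (- A @\<^sub>r - C) (1\<^sub>m n @\<^sub>r - 0\<^sub>m p n)"
    using A C by (simp add: char_poly_matrix_eq_pencil const_pmat_eq_pencil[where a = p and b = n]
        uminus_pencil[where a = p and b = n] append_rows_pencil[where a = n and b = p and n = n])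
  have car: "- A @\<^sub>r - C \<in> carrier_mat (n + p) n" "1\<^sub>m n @\<^sub>r - 0\<^sub>m p n \<in> carrier_mat (n + p) n"
    "P0 @\<^sub>c Q0 \<in> carrier_mat n (n + p)" "P1 @\<^sub>c Q1 \<in> carrier_mat n (n + p)"
    using A C P Q by auto
  have prods: "(P0 @\<^sub>c Q0) * (- A @\<^sub>r - C) = - (P0 * A) - Q0 * C"
    "(P0 @\<^sub>c Q0) * (1\<^sub>m n @\<^sub>r - 0\<^sub>m p n) + (P1 @\<^sub>c Q1) * (- A @\<^sub>r - C) = P0 - P1 * A - Q1 * C"
    "(P1 @\<^sub>c Q1) * (1\<^sub>m n @\<^sub>r - 0\<^sub>m p n) = P1"
    using P Q A C by (auto simp: append_cols_mult_append_rows[where a = n and b = p and n = n and c = n] intro!: eq_matI)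
  have "pencil (P0 @\<^sub>c Q0) (P1 @\<^sub>c Q1) * (char_poly_matrix A @\<^sub>r - const_pmat C) = char_poly_matrix Ao
     \<longleftrightarrow> quad_pencil (- (P0 * A) - Q0 * C) (P0 - P1 * A - Q1 * C) P1 = quad_pencil (- Ao) (1\<^sub>m n) (0\<^sub>m n n)"
    unfolding rhs pencil_mult_pencil[OF car(3,4,1,2)] prods
    using Ao by (simp add: char_poly_matrix_eq_pencil pencil_eq_quad[where a = n and b = n])
  also have "\<dots> \<longleftrightarrow> - (P0 * A) - Q0 * C = - Ao \<and> P0 - P1 * A - Q1 * C = 1\<^sub>m n \<and> P1 = 0\<^sub>m n n"
    using P Q A C Ao by (intro quad_pencil_eq_iff[where a = n and b = n]) auto
  also have "\<dots> \<longleftrightarrow> P1 = 0\<^sub>m n n \<and> P0 = 1\<^sub>m n + Q1 * C \<and> Ao = P0 * A + Q0 * C"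
  proof -
    have "- (P0 * A) - Q0 * C = - (P0 * A + Q0 * C)"
      using P Q A C by (intro uminus_minus_mat) auto
    moreover have "P0 - 0\<^sub>m n n - Q1 * C = 1\<^sub>m n \<longleftrightarrow> P0 - Q1 * C = 1\<^sub>m n"
    proof -
      have "P0 - 0\<^sub>m n n = P0"
        using P by (intro eq_matI) auto
      then show ?thesis by simp
    qed
    moreover have "P0 - Q1 * C = 1\<^sub>m n \<longleftrightarrow> P0 = 1\<^sub>m n + Q1 * C"
      using P Q C by (intro minus_mat_eq_iff) auto
    ultimately show ?thesis
      using A by auto
  qed
  finally show ?thesis .
qed

lemma pencil_mult_const_columns:
  assumes S: "S0 \<in> carrier_mat n (k + l)" "S1 \<in> carrier_mat n (k + l)"
    and X: "X \<in> carrier_mat k c" and Y: "Y \<in> carrier_mat l c"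
  shows "pencil S0 S1 * (- const_pmat X @\<^sub>r - const_pmat Y) = pencil (- (S0 * (X @\<^sub>r Y))) (- (S1 * (X @\<^sub>r Y)))"
proof -
  have XY: "X @\<^sub>r Y \<in> carrier_mat (k + l) c"
    using X Y by auto
  have "- const_pmat X @\<^sub>r - const_pmat Y = - const_pmat (X @\<^sub>r Y)"
    using X Y by (intro eq_matI) (auto simp: const_pmat_def append_rows_def)
  moreover have "pencil S0 S1 * - const_pmat (X @\<^sub>r Y) = - (pencil S0 S1 * const_pmat (X @\<^sub>r Y))"
    using S XY by (intro uminus_mult_right_mat) (auto simp: pencil_def const_pmat_def)
  moreover have "pencil S0 S1 * const_pmat (X @\<^sub>r Y) = pencil (S0 * (X @\<^sub>r Y)) (S1 * (X @\<^sub>r Y))"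
    by (rule pencil_mult_const[OF S XY])
  moreover have "- pencil (S0 * (X @\<^sub>r Y)) (S1 * (X @\<^sub>r Y)) = pencil (- (S0 * (X @\<^sub>r Y))) (- (S1 * (X @\<^sub>r Y)))"
    using S XY by (intro uminus_pencil[where a = n and b = c]) auto
  ultimately show ?thesis by simp
qed

text \<open>The disturbance columns are free of z, so the product with them is again a pencil, and
  its vanishing splits into one condition for each coefficient of S(z).\<close>

lemma pencil_mult_disturbance_columns:
  assumes S: "S0 \<in> carrier_mat n (n + p)" "S1 \<in> carrier_mat n (n + p)"
    and A: "A \<in> carrier_mat n n" and C: "C \<in> carrier_mat p n" and Ao: "Ao \<in> carrier_mat n n"
    and E: "E \<in> carrier_mat n r" and F: "F \<in> carrier_mat p r"
  shows "pencil S0 S1 *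
      four_block_mat (char_poly_matrix A) (- const_pmat E) (- const_pmat C) (- const_pmat F)
      = char_poly_matrix Ao @\<^sub>c 0\<^sub>m n r
    \<longleftrightarrow> pencil S0 S1 * (char_poly_matrix A @\<^sub>r - const_pmat C) = char_poly_matrix Ao
      \<and> S0 * (E @\<^sub>r F) = 0\<^sub>m n r \<and> S1 * (E @\<^sub>r F) = 0\<^sub>m n r"
proof -
  have EF: "E @\<^sub>r F \<in> carrier_mat (n + p) r"
    using E F by auto
  have dist: "pencil S0 S1 * (- const_pmat E @\<^sub>r - const_pmat F) = 0\<^sub>m n r
     \<longleftrightarrow> S0 * (E @\<^sub>r F) = 0\<^sub>m n r \<and> S1 * (E @\<^sub>r F) = 0\<^sub>m n r"
    using S EF pencil_mult_const_columns[OF S E F]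
    by (simp add: zero_eq_pencil[of n r] pencil_eq_iff[where a = n and b = r] uminus_mat_eq_zero_iff)
  have "pencil S0 S1 * four_block_mat (char_poly_matrix A) (- const_pmat E) (- const_pmat C) (- const_pmat F)
     = (pencil S0 S1 * (char_poly_matrix A @\<^sub>r - const_pmat C)) @\<^sub>c
       (pencil S0 S1 * (- const_pmat E @\<^sub>r - const_pmat F))"
    using S A C E F
    by (simp add: four_block_mat_eq_append(1)[where ?n1.0 = n and ?m1.0 = n and ?n2.0 = p and ?m2.0 = r]
        mult_append_cols[where n = n and k = "n + p" and a = n and b = r])
  moreover have "pencil S0 S1 * (char_poly_matrix A @\<^sub>r - const_pmat C) \<in> carrier_mat n n"
    "pencil S0 S1 * (- const_pmat E @\<^sub>r - const_pmat F) \<in> carrier_mat n r"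
    using S A C E F by (auto intro!: mult_carrier_mat[where n = "n + p"])
  ultimately show ?thesis
    using Ao by (simp add: append_cols_eq_iff[where n = n and a = n and b = r] dist)
qed

text \<open>Separates the state, input and output columns of (ii), with S(z) in place of T(z) times
  \<open>[M_E M_F]\<close>. The state columns give the equation of (iii); the other two serve to
  read off the observer matrices.\<close>

lemma observer_pencil_iff:
  assumes S: "S0 \<in> carrier_mat n (n + p)" "S1 \<in> carrier_mat n (n + p)"
    and A: "A \<in> carrier_mat n n" and C: "C \<in> carrier_mat p n" and Ao: "Ao \<in> carrier_mat n n"
    and B: "B \<in> carrier_mat n m" and D: "D \<in> carrier_mat p m"
    and Bu: "Bu \<in> carrier_mat n m" and By: "By \<in> carrier_mat n p"
    and Du: "Du \<in> carrier_mat n m" and Dy: "Dy \<in> carrier_mat n p"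
  shows "char_poly_matrix Ao @\<^sub>c
         (- const_pmat Bu - char_poly_matrix Ao * const_pmat Du) @\<^sub>c
         (- const_pmat By - char_poly_matrix Ao * const_pmat Dy)
       = pencil S0 S1 *
         ((char_poly_matrix A @\<^sub>c (- const_pmat B) @\<^sub>c 0\<^sub>m n p) @\<^sub>r
          ((- const_pmat C) @\<^sub>c (- const_pmat D) @\<^sub>c 1\<^sub>m p))
    \<longleftrightarrow> char_poly_matrix Ao = pencil S0 S1 * (char_poly_matrix A @\<^sub>r - const_pmat C)
      \<and> - const_pmat Bu - char_poly_matrix Ao * const_pmat Du
          = pencil S0 S1 * (- const_pmat B @\<^sub>r - const_pmat D)
      \<and> - const_pmat By - char_poly_matrix Ao * const_pmat Dy = pencil S0 S1 * (0\<^sub>m n p @\<^sub>r 1\<^sub>m p)"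
proof -
  let ?X1 = "char_poly_matrix A @\<^sub>r - const_pmat C"
  let ?X2 = "- const_pmat B @\<^sub>r - const_pmat D"
  let ?X3 = "0\<^sub>m n p @\<^sub>r 1\<^sub>m p :: real poly mat"
  have X: "?X1 \<in> carrier_mat (n + p) n" "?X2 \<in> carrier_mat (n + p) m" "?X3 \<in> carrier_mat (n + p) p"
    using A B C D by auto
  have pS: "pencil S0 S1 \<in> carrier_mat n (n + p)"
    using S by simp
  have "(char_poly_matrix A @\<^sub>c (- const_pmat B) @\<^sub>c 0\<^sub>m n p) @\<^sub>r
          ((- const_pmat C) @\<^sub>c (- const_pmat D) @\<^sub>c 1\<^sub>m p) = ?X1 @\<^sub>c ?X2 @\<^sub>c ?X3"
    using A B C D
    by (simp add: append_rows_append_cols[where ?n1.0 = n and ?n2.0 = p and ?m1.0 = n and ?m2.0 = "m + p"]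
      append_rows_append_cols[where ?n1.0 = n and ?n2.0 = p and ?m1.0 = m and ?m2.0 = p])
  then have "pencil S0 S1 * ((char_poly_matrix A @\<^sub>c (- const_pmat B) @\<^sub>c 0\<^sub>m n p) @\<^sub>r
          ((- const_pmat C) @\<^sub>c (- const_pmat D) @\<^sub>c 1\<^sub>m p))
      = (pencil S0 S1 * ?X1) @\<^sub>c (pencil S0 S1 * ?X2) @\<^sub>c (pencil S0 S1 * ?X3)"
    using mult_append_cols[OF pS X(1) append_cols_carrier[OF X(2,3)]] mult_append_cols[OF pS X(2,3)]
    by simp
  moreover have "- const_pmat Bu - char_poly_matrix Ao * const_pmat Du \<in> carrier_mat n m"
    and "- const_pmat By - char_poly_matrix Ao * const_pmat Dy \<in> carrier_mat n p"
    and "char_poly_matrix Ao \<in> carrier_mat n n"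
    using Ao Du Dy by (auto intro!: mult_carrier_mat minus_carrier_mat)
  moreover have "pencil S0 S1 * ?X1 \<in> carrier_mat n n" "pencil S0 S1 * ?X2 \<in> carrier_mat n m"
    "pencil S0 S1 * ?X3 \<in> carrier_mat n p"
    using pS X by (auto intro: mult_carrier_mat)
  ultimately show ?thesis
    by (simp add: append_cols_eq_iff[where n = n and a = n and b = "m + p"]
        append_cols_eq_iff[where n = n and a = m and b = p])
qed

text \<open>Any pencil K0 + K1 z of this size has this form: take \<open>Y = - K1\<close> and
  \<open>X = Ao * Y - K0\<close>. Hence the input and output columns of (ii) can always be
  matched.\<close>

lemma char_poly_matrix_affine_eq_pencil:
  assumes "Ao \<in> carrier_mat n n" "X \<in> carrier_mat n k" "Y \<in> carrier_mat n k"
  shows "- const_pmat X - char_poly_matrix Ao * const_pmat Y = pencil (Ao * Y - X) (- Y)"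
proof -
  have "char_poly_matrix Ao * const_pmat Y = pencil (- (Ao * Y)) Y"
    using assms by (simp add: char_poly_matrix_eq_pencil pencil_mult_const[where a = n and b = n and c = k])
  moreover have "- const_pmat X = pencil (- X) (0\<^sub>m n k)"
    using assms by (intro eq_matI) (auto simp: pencil_def const_pmat_def)
  ultimately show ?thesis
    using assms by (simp add: minus_pencil[where a = n and b = k]) (intro arg_cong2[where f = pencil] eq_matI; auto)
qed

section \<open>Schur stability and convergence of matrix powers\<close>

lemma eigenvalue_smult:
  fixes A :: "complex mat"
  assumes A: "A \<in> carrier_mat n n" and s: "s \<noteq> 0" and ev: "eigenvalue ((1 / s) \<cdot>\<^sub>m A) l"
  shows "eigenvalue A (s * l)"
proof -
  obtain v where v: "v \<in> carrier_vec n" "v \<noteq> 0\<^sub>v n" and eq: "((1 / s) \<cdot>\<^sub>m A) *\<^sub>v v = l \<cdot>\<^sub>v v"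
    using ev A by (auto simp: eigenvalue_def eigenvector_def)
  have "A *\<^sub>v v = (s * l) \<cdot>\<^sub>v v"
  proof (rule eq_vecI)
    fix i assume "i < dim_vec ((s * l) \<cdot>\<^sub>v v)"
    then have i: "i < n" using v by simp
    have "(1 / s) * (row A i \<bullet> v) = l * v $ i"
      using arg_cong[OF eq, of "\<lambda>w. w $ i"] A v i by simp
    then show "(A *\<^sub>v v) $ i = ((s * l) \<cdot>\<^sub>v v) $ i"
      using A v i s by (simp add: field_simps)
  qed (use A v in auto)
  then show ?thesis
    using A v by (auto simp: eigenvalue_def eigenvector_def)
qed

lemma pow_smult_mat:
  fixes A :: "'a :: comm_ring_1 mat"
  assumes A: "A \<in> carrier_mat n n"
  shows "(c \<cdot>\<^sub>m A) ^\<^sub>m k = c ^ k \<cdot>\<^sub>m (A ^\<^sub>m k)"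
proof (induction k)
  case (Suc k)
  have Ak: "A ^\<^sub>m k \<in> carrier_mat n n"
    using A by simp
  have "(c \<cdot>\<^sub>m A) ^\<^sub>m Suc k = (c ^ k \<cdot>\<^sub>m (A ^\<^sub>m k)) * (c \<cdot>\<^sub>m A)"
    by (simp add: Suc)
  also have "\<dots> = c ^ Suc k \<cdot>\<^sub>m (A ^\<^sub>m k * A)"
    using A Ak by (intro eq_matI) (auto simp: algebra_simps)
  finally show ?case by simp
qed (auto intro: eq_matI)

text \<open>\<open>A ^\<^sub>m Suc k\<close> unfolds with the new factor on the right, whereas one
  step of a linear recursion multiplies by \<open>A\<close> on the left.\<close>

lemma pow_mat_Suc_left:
  fixes A :: "'a :: semiring_1 mat"
  assumes A: "A \<in> carrier_mat n n"
  shows "A * A ^\<^sub>m k = A ^\<^sub>m Suc k"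
proof (induction k)
  case (Suc k)
  have "A * A ^\<^sub>m Suc k = A * A ^\<^sub>m k * A"
    using A by (simp add: assoc_mult_mat[of A n n "A ^\<^sub>m k" n A n])
  then show ?case
    by (simp add: Suc)
qed (use A in auto)

text \<open>For s strictly between the spectral radius and 1, the matrix \<open>A / s\<close> still
  has spectral radius below 1, so its powers are bounded entrywise by some c. Scaling back bounds
  the entries of the k-th power of \<open>A\<close> by c s^k.\<close>

lemma schur_stable_pow_tendsto_zero:
  assumes A: "A \<in> carrier_mat n n" and stable: "schur_stable A" and ij: "i < n" "j < n"
  shows "(\<lambda>k. (A ^\<^sub>m k) $$ (i, j)) \<longlonglongrightarrow> 0"
proof -
  let ?A = "map_mat complex_of_real A"
  have cA: "?A \<in> carrier_mat n n" and n: "n > 0"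
    using A ij by auto
  define \<rho> where "\<rho> = spectral_radius ?A"
  have "\<rho> \<in> norm ` spectrum ?A"
    unfolding \<rho>_def by (rule spectral_radius_mem_max(1)[OF cA n])
  then have \<rho>: "0 \<le> \<rho>" "\<rho> < 1"
    using stable by (auto simp: spectrum_def schur_stable_def)
  \<comment> \<open>The midpoint of \<rho> and 1 stays positive even if \<rho> = 0, so dividing by
    it is legitimate.\<close>
  define s where "s = (\<rho> + 1) / 2"
  have s: "0 < s" "\<rho> < s" "s < 1"
    using \<rho> by (auto simp: s_def)
  let ?G = "(1 / complex_of_real s) \<cdot>\<^sub>m ?A"
  have cG: "?G \<in> carrier_mat n n"
    using cA by simp
  have "spectral_radius ?G < 1"
  proof -
    obtain l where l: "eigenvalue ?G l" "spectral_radius ?G = norm l"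
      using spectral_radius_mem_max(1)[OF cG n] by (auto simp: spectrum_def)
    have "eigenvalue ?A (complex_of_real s * l)"
      using eigenvalue_smult[OF cA _ l(1)] s by simp
    then have "norm (complex_of_real s * l) \<le> \<rho>"
      unfolding \<rho>_def by (intro spectral_radius_mem_max(2)[OF cA n]) (auto simp: spectrum_def)
    then have "s * norm l \<le> \<rho>"
      using s by (simp add: norm_mult)
    then have "s * norm l < s * 1"
      using s by linarith
    then show ?thesis
      using s l(2) mult_less_cancel_left_pos by metis
  qed
  then obtain c where c: "\<And>k. norm_bound (?G ^\<^sub>m k) c"
    using spectral_radius_jnf_norm_bound_less_1_upper_triangular[OF cG] by blast
  have "norm ((A ^\<^sub>m k) $$ (i, j)) \<le> c * s ^ k" for k
  proof -
    have "?G ^\<^sub>m k = (1 / complex_of_real s) ^ k \<cdot>\<^sub>m map_mat complex_of_real (A ^\<^sub>m k)"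
      by (simp add: pow_smult_mat[OF cA] of_real_hom.mat_hom_pow[OF A])
    then have "(?G ^\<^sub>m k) $$ (i, j) = (1 / complex_of_real s) ^ k * complex_of_real ((A ^\<^sub>m k) $$ (i, j))"
      using A ij by simp
    moreover have "norm ((?G ^\<^sub>m k) $$ (i, j)) \<le> c"
      using c[of k] ij carrier_matD[OF pow_carrier_mat[OF cG, of k]] by (simp only: norm_bound_def)
    moreover have "norm ((A ^\<^sub>m k) $$ (i, j)) = s ^ k * norm ((?G ^\<^sub>m k) $$ (i, j))"
      using s by (simp add: calculation(1) norm_mult norm_power norm_divide field_simps)
    ultimately show ?thesis
      using s by (simp add: mult.commute[of c] mult_left_mono)
  qed
  then have bound: "norm ((A ^\<^sub>m k) $$ (i, j)) \<le> norm (c * s ^ k) * 1" for k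
    by (rule order_trans[OF _ order_trans[OF abs_ge_self]]) simp
  have "(\<lambda>k. c * s ^ k) \<longlonglongrightarrow> 0"
    using s by (intro tendsto_mult_right_zero LIMSEQ_power_zero) auto
  then show ?thesis
    by (rule tendsto_0_le[where K = 1]) (intro always_eventually allI bound)
qed

text \<open>For stable \<open>A\<close>, each entry of \<open>A^k v\<close> is a finite sum of null
  sequences. Conversely, an eigenvector \<open>w\<close> may be complex while convergence is assumed
  for real vectors only, so it is applied to the real and imaginary parts of \<open>w\<close>. Then
  \<open>l^k w_i\<close> tends to 0, and at an index where \<open>w_i\<close> is nonzero so does
  \<open>l^k\<close>.\<close>

lemma schur_stable_iff_pow_mult_vec_tendsto_zero:
  assumes A: "A \<in> carrier_mat n n"
  shows "schur_stable A \<longleftrightarrow> (\<forall>v \<in> carrier_vec n. tends_to_zero (\<lambda>k. A ^\<^sub>m k *\<^sub>v v) n)"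
proof
  assume stable: "schur_stable A"
  have "(\<lambda>k. (A ^\<^sub>m k *\<^sub>v v) $ i) \<longlonglongrightarrow> 0" if v: "v \<in> carrier_vec n" and i: "i < n" for v i
  proof -
    have "(A ^\<^sub>m k *\<^sub>v v) $ i = (\<Sum>j\<in>{0..<n}. (A ^\<^sub>m k) $$ (i, j) * v $ j)" for k
      using A v i by (simp add: scalar_prod_def)
    moreover have "(\<lambda>k. \<Sum>j\<in>{0..<n}. (A ^\<^sub>m k) $$ (i, j) * v $ j) \<longlonglongrightarrow> 0"
      using schur_stable_pow_tendsto_zero[OF A stable i]
      by (intro tendsto_null_sum tendsto_mult_left_zero) auto
    ultimately show ?thesis by simp
  qed
  then show "\<forall>v \<in> carrier_vec n. tends_to_zero (\<lambda>k. A ^\<^sub>m k *\<^sub>v v) n"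
    by (auto simp: tends_to_zero_def)
next
  assume lim: "\<forall>v \<in> carrier_vec n. tends_to_zero (\<lambda>k. A ^\<^sub>m k *\<^sub>v v) n"
  let ?A = "map_mat complex_of_real A"
  have cA: "?A \<in> carrier_mat n n"
    using A by simp
  have "cmod l < 1" if ev: "eigenvalue ?A l" for l
  proof -
    obtain w where w: "eigenvector ?A w l"
      using ev by (auto simp: eigenvalue_def)
    then have wc: "w \<in> carrier_vec n" and "w \<noteq> 0\<^sub>v n"
      using A by (auto simp: eigenvector_def)
    then obtain i where i: "i < n" "w $ i \<noteq> 0"
      by (auto simp: vec_eq_iff)
    have "l ^ k * w $ i = complex_of_real ((A ^\<^sub>m k *\<^sub>v map_vec Re w) $ i)
        + \<i> * complex_of_real ((A ^\<^sub>m k *\<^sub>v map_vec Im w) $ i)" for k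
    proof -
      have "l ^ k * w $ i = (l ^ k \<cdot>\<^sub>v w) $ i"
        using wc i by simp
      also have "\<dots> = (map_mat complex_of_real (A ^\<^sub>m k) *\<^sub>v w) $ i"
        by (simp add: eigenvector_pow[OF cA w, symmetric] of_real_hom.mat_hom_pow[OF A])
      also have "\<dots> = (\<Sum>j\<in>{0..<n}. complex_of_real ((A ^\<^sub>m k) $$ (i, j)) * w $ j)"
        using A wc i by (simp add: scalar_prod_def)
      also have "\<dots> = (\<Sum>j\<in>{0..<n}. complex_of_real ((A ^\<^sub>m k) $$ (i, j) * Re (w $ j))
          + \<i> * complex_of_real ((A ^\<^sub>m k) $$ (i, j) * Im (w $ j)))"
        by (intro sum.cong refl) (simp add: complex_eq_iff)
      also have "\<dots> = complex_of_real ((A ^\<^sub>m k *\<^sub>v map_vec Re w) $ i)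
        + \<i> * complex_of_real ((A ^\<^sub>m k *\<^sub>v map_vec Im w) $ i)"
        using A wc i by (simp add: scalar_prod_def sum.distrib sum_distrib_left)
      finally show ?thesis .
    qed
    moreover have "(\<lambda>k. (A ^\<^sub>m k *\<^sub>v map_vec Re w) $ i) \<longlonglongrightarrow> 0"
      "(\<lambda>k. (A ^\<^sub>m k *\<^sub>v map_vec Im w) $ i) \<longlonglongrightarrow> 0"
      using lim wc i by (auto simp: tends_to_zero_def)
    then have "(\<lambda>k. complex_of_real ((A ^\<^sub>m k *\<^sub>v map_vec Re w) $ i)
        + \<i> * complex_of_real ((A ^\<^sub>m k *\<^sub>v map_vec Im w) $ i)) \<longlonglongrightarrow> of_real 0 + \<i> * of_real 0"
      by (intro tendsto_intros)
    ultimately have "(\<lambda>k. l ^ k * w $ i) \<longlonglongrightarrow> 0"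
      by simp
    from tendsto_mult[OF this tendsto_const[of "inverse (w $ i)"]]
    have "(\<lambda>k. l ^ k) \<longlonglongrightarrow> 0"
      using i by (simp add: mult.assoc)
    \<comment> \<open>One power of modulus below 1 is enough: if the modulus of \<open>l\<close>
      were at least 1, so would be that of every power.\<close>
    from order_tendstoD(2)[OF tendsto_norm[OF this], of 1]
    obtain k where "cmod l ^ k < 1"
      by (auto simp: eventually_sequentially norm_power)
    then show ?thesis
      using one_le_power[of "cmod l" k] by linarith
  qed
  then show "schur_stable A"
    using A by (auto simp: schur_stable_def)
qed

section \<open>Matrix identities tested on vectors\<close>

text \<open>Stated with dimensions instead of carriers: the premises then have no free inner dimension,
  so the simplifier can discharge them.\<close>

lemma mat_distrib_dims:
  fixes X Y Z :: "'a :: comm_ring_1 mat"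
  shows "dim_row X = dim_row Y \<Longrightarrow> dim_col X = dim_col Y \<Longrightarrow> dim_row Z = dim_col X \<Longrightarrow>
      (X + Y) * Z = X * Z + Y * Z"
    and "dim_row X = dim_row Y \<Longrightarrow> dim_col X = dim_col Y \<Longrightarrow> dim_row Z = dim_col X \<Longrightarrow>
      (X - Y) * Z = X * Z - Y * Z"
    and "dim_row X = dim_row Y \<Longrightarrow> dim_col X = dim_col Y \<Longrightarrow> dim_col Z = dim_row X \<Longrightarrow>
      Z * (X + Y) = Z * X + Z * Y"
    and "dim_row X = dim_row Y \<Longrightarrow> dim_col X = dim_col Y \<Longrightarrow> dim_col Z = dim_row X \<Longrightarrow>
      Z * (X - Y) = Z * X - Z * Y"
    and "dim_col X = dim_row Y \<Longrightarrow> dim_col Y = dim_row Z \<Longrightarrow> X * Y * Z = X * (Y * Z)"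
  by (auto intro!: add_mult_distrib_mat minus_mult_distrib_mat mult_add_distrib_mat
      mult_minus_distrib_mat assoc_mult_mat)

lemma mat_vec_distrib_dims:
  fixes X Y :: "'a :: comm_ring_1 mat" and v w :: "'a vec"
  shows "dim_row X = dim_row Y \<Longrightarrow> dim_col X = dim_col Y \<Longrightarrow> dim_vec v = dim_col X \<Longrightarrow>
      (X + Y) *\<^sub>v v = X *\<^sub>v v + Y *\<^sub>v v"
    and "dim_row X = dim_row Y \<Longrightarrow> dim_col X = dim_col Y \<Longrightarrow> dim_vec v = dim_col X \<Longrightarrow>
      (X - Y) *\<^sub>v v = X *\<^sub>v v - Y *\<^sub>v v"
    and "dim_vec v = dim_col X \<Longrightarrow> dim_vec w = dim_col X \<Longrightarrow> X *\<^sub>v (v + w) = X *\<^sub>v v + X *\<^sub>v w"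
    and "dim_vec v = dim_col X \<Longrightarrow> dim_vec w = dim_col X \<Longrightarrow> X *\<^sub>v (v - w) = X *\<^sub>v v - X *\<^sub>v w"
    and "dim_col X = dim_row Y \<Longrightarrow> dim_vec v = dim_col Y \<Longrightarrow> X * Y *\<^sub>v v = X *\<^sub>v (Y *\<^sub>v v)"
  by (auto intro!: add_mult_distrib_mat_vec minus_mult_distrib_mat_vec mult_add_distrib_mat_vec
      mult_minus_distrib_mat_vec assoc_mult_mat_vec carrier_vecI)

lemma zero_mat_mult_vec [simp]:
  fixes v :: "'a :: comm_ring_1 vec"
  shows "v \<in> carrier_vec k \<Longrightarrow> 0\<^sub>m n k *\<^sub>v v = 0\<^sub>v n"
  by (intro eq_vecI) auto

lemma mat_mult_zero_vec [simp]:
  fixes X :: "'a :: comm_ring_1 mat"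
  shows "X \<in> carrier_mat n k \<Longrightarrow> X *\<^sub>v 0\<^sub>v k = 0\<^sub>v n"
  by (intro eq_vecI) auto

lemma mat_eq_zero_iff_mult_vec:
  fixes K :: "'a :: comm_ring_1 mat"
  assumes K: "K \<in> carrier_mat n k"
  shows "K = 0\<^sub>m n k \<longleftrightarrow> (\<forall>v \<in> carrier_vec k. K *\<^sub>v v = 0\<^sub>v n)"
proof
  assume zero: "\<forall>v \<in> carrier_vec k. K *\<^sub>v v = 0\<^sub>v n"
  show "K = 0\<^sub>m n k"
  proof (rule eq_matI)
    fix i j assume ij: "i < dim_row (0\<^sub>m n k :: 'a mat)" "j < dim_col (0\<^sub>m n k :: 'a mat)"
    have "(K *\<^sub>v unit_vec k j) $ i = 0"
      using zero ij unit_vec_carrier[of k j] by simp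
    then show "K $$ (i, j) = 0\<^sub>m n k $$ (i, j)"
      using K ij by simp
  qed (use K in auto)
qed (simp)

text \<open>Setting all vectors but one to zero isolates each matrix. The five slots are meant for
  x(t), u(t), u(t+1), d(t) and d(t+1).\<close>

lemma sum_mult_vec_eq_zero_iff:
  fixes K1 :: "'a :: comm_ring_1 mat"
  assumes K: "K1 \<in> carrier_mat n k1" "K2 \<in> carrier_mat n k2" "K3 \<in> carrier_mat n k3"
    "K4 \<in> carrier_mat n k4" "K5 \<in> carrier_mat n k5"
  shows "(\<forall>v1 \<in> carrier_vec k1. \<forall>v2 \<in> carrier_vec k2. \<forall>v3 \<in> carrier_vec k3.
       \<forall>v4 \<in> carrier_vec k4. \<forall>v5 \<in> carrier_vec k5.
       K1 *\<^sub>v v1 + K2 *\<^sub>v v2 + K3 *\<^sub>v v3 + K4 *\<^sub>v v4 + K5 *\<^sub>v v5 = 0\<^sub>v n)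
    \<longleftrightarrow> K1 = 0\<^sub>m n k1 \<and> K2 = 0\<^sub>m n k2 \<and> K3 = 0\<^sub>m n k3 \<and> K4 = 0\<^sub>m n k4 \<and> K5 = 0\<^sub>m n k5"
    (is "?sum \<longleftrightarrow> ?zero")
proof
  assume sum: ?sum
  note zeros = zero_carrier_vec[of k1] zero_carrier_vec[of k2] zero_carrier_vec[of k3]
    zero_carrier_vec[of k4] zero_carrier_vec[of k5]
  have "K1 *\<^sub>v v = 0\<^sub>v n" if "v \<in> carrier_vec k1" for v
    using sum[rule_format, OF that zeros(2-5)] K that by simp
  moreover have "K2 *\<^sub>v v = 0\<^sub>v n" if "v \<in> carrier_vec k2" for v
    using sum[rule_format, OF zeros(1) that zeros(3-5)] K that by simp
  moreover have "K3 *\<^sub>v v = 0\<^sub>v n" if "v \<in> carrier_vec k3" for v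
    using sum[rule_format, OF zeros(1,2) that zeros(4,5)] K that by simp
  moreover have "K4 *\<^sub>v v = 0\<^sub>v n" if "v \<in> carrier_vec k4" for v
    using sum[rule_format, OF zeros(1-3) that zeros(5)] K that by simp
  moreover have "K5 *\<^sub>v v = 0\<^sub>v n" if "v \<in> carrier_vec k5" for v
    using sum[rule_format, OF zeros(1-4) that] K that by simp
  ultimately show ?zero
    using K by (simp add: mat_eq_zero_iff_mult_vec)
qed simp

section \<open>Acceptor property and error dynamics of an observer\<close>

locale lti_observer =
  fixes A B C D E F Ao Bu By Du Dy :: "real mat" and n m p r :: nat
  assumes carriers: "A \<in> carrier_mat n n" "B \<in> carrier_mat n m" "E \<in> carrier_mat n r"
    "C \<in> carrier_mat p n" "D \<in> carrier_mat p m" "F \<in> carrier_mat p r"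
    "Ao \<in> carrier_mat n n" "Bu \<in> carrier_mat n m" "By \<in> carrier_mat n p"
    "Du \<in> carrier_mat n m" "Dy \<in> carrier_mat n p"
begin

lemma dims [simp]:
  "dim_row A = n" "dim_col A = n" "dim_row B = n" "dim_col B = m" "dim_row E = n" "dim_col E = r"
  "dim_row C = p" "dim_col C = n" "dim_row D = p" "dim_col D = m" "dim_row F = p" "dim_col F = r"
  "dim_row Ao = n" "dim_col Ao = n" "dim_row Bu = n" "dim_col Bu = m" "dim_row By = n" "dim_col By = p"
  "dim_row Du = n" "dim_col Du = m" "dim_row Dy = n" "dim_col Dy = p"
  using carriers by auto

text \<open>The state equation of the observer at one time step, with the output of the observer equal to
  \<open>x\<close> and the observer state eliminated; primes denote values at the next time step.\<close>

definition consistent_step :: "real vec \<Rightarrow> real vec \<Rightarrow> real vec \<Rightarrow> real vec \<Rightarrow> real vec \<Rightarrow> bool" where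
  "consistent_step x u u' d d' \<longleftrightarrow>
     (let y = C *\<^sub>v x + D *\<^sub>v u + F *\<^sub>v d; x' = A *\<^sub>v x + B *\<^sub>v u + E *\<^sub>v d;
          y' = C *\<^sub>v x' + D *\<^sub>v u' + F *\<^sub>v d'
      in x' - Du *\<^sub>v u' - Dy *\<^sub>v y' = Ao *\<^sub>v (x - Du *\<^sub>v u - Dy *\<^sub>v y) + Bu *\<^sub>v u + By *\<^sub>v y)"

lemma consistent_stepI:
  assumes "sys_trajectory A B C D E F x u y d" and "obs_trajectory Ao Bu By Du Dy x u y z"
  shows "consistent_step (x t) (u t) (u (Suc t)) (d t) (d (Suc t))"
proof -
  have z: "z t = x t - Du *\<^sub>v u t - Dy *\<^sub>v y t" for t
  proof (rule eq_vecI)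
    fix i assume i: "i < dim_vec (x t - Du *\<^sub>v u t - Dy *\<^sub>v y t)"
    have "x t = z t + Du *\<^sub>v u t + Dy *\<^sub>v y t"
      using assms(2) by (simp add: obs_trajectory_def)
    from arg_cong[OF this, of "\<lambda>v. v $ i"] show "z t $ i = (x t - Du *\<^sub>v u t - Dy *\<^sub>v y t) $ i"
      using i by (simp del: index_mult_mat_vec)
  qed (use assms(2) in \<open>auto simp: obs_trajectory_def\<close>)
  have "z (Suc t) = Ao *\<^sub>v z t + Bu *\<^sub>v u t + By *\<^sub>v y t"
    using assms(2) by (simp add: obs_trajectory_def)
  moreover have "y t = C *\<^sub>v x t + D *\<^sub>v u t + F *\<^sub>v d t" "x (Suc t) = A *\<^sub>v x t + B *\<^sub>v u t + E *\<^sub>v d t"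
    for t using assms(1) by (simp_all add: sys_trajectory_def)
  ultimately show ?thesis
    unfolding consistent_step_def Let_def z by metis
qed

text \<open>The step condition involves two consecutive times only, and x(0), u(0), u(1), d(0), d(1)
  can be prescribed freely. So every choice of the five vectors occurs at time 0 of some
  trajectory.\<close>

lemma is_acceptor_iff_consistent_step:
  "is_acceptor A B C D E F Ao Bu By Du Dy \<longleftrightarrow>
     (\<forall>x \<in> carrier_vec n. \<forall>u \<in> carrier_vec m. \<forall>u' \<in> carrier_vec m.
      \<forall>d \<in> carrier_vec r. \<forall>d' \<in> carrier_vec r. consistent_step x u u' d d')"
proof (intro iffI ballI)
  fix x u u' d d' :: "real vec"
  assume acc: "is_acceptor A B C D E F Ao Bu By Du Dy"
    and v: "x \<in> carrier_vec n" "u \<in> carrier_vec m" "u' \<in> carrier_vec m" "d \<in> carrier_vec r" "d' \<in> carrier_vec r"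
  \<comment> \<open>The signals take the prescribed values at times 0 and 1; repeating the second
    value merely completes the trajectory.\<close>
  define us where "us t = (if t = 0 then u else u')" for t :: nat
  define ds where "ds t = (if t = 0 then d else d')" for t :: nat
  define xs where "xs = rec_nat x (\<lambda>t x. A *\<^sub>v x + B *\<^sub>v us t + E *\<^sub>v ds t)"
  define ys where "ys t = C *\<^sub>v xs t + D *\<^sub>v us t + F *\<^sub>v ds t" for t
  have xs: "xs 0 = x" "xs (Suc t) = A *\<^sub>v xs t + B *\<^sub>v us t + E *\<^sub>v ds t" for t
    by (simp_all add: xs_def)
  have us: "us t \<in> carrier_vec m" and ds: "ds t \<in> carrier_vec r" for t
    using v by (auto simp: us_def ds_def)
  have "dim_vec (xs t) = n" for t
  proof (cases t)
    case 0
    show ?thesis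
      unfolding 0 xs(1) using v(1) by (rule carrier_vecD)
  next
    case (Suc k)
    show ?thesis
      unfolding Suc xs(2) by (simp only: index_add_vec dim_mult_mat_vec dims)
  qed
  then have "xs t \<in> carrier_vec n" for t
    by (intro carrier_vecI)
  moreover have "ys t \<in> carrier_vec p" for t
    by (intro carrier_vecI) (simp only: ys_def index_add_vec dim_mult_mat_vec dims)
  ultimately have sys: "sys_trajectory A B C D E F xs us ys ds"
    unfolding sys_trajectory_def dims by (intro allI conjI us ds xs(2) ys_def)
  then obtain z where "obs_trajectory Ao Bu By Du Dy xs us ys z"
    using acc unfolding is_acceptor_def by blast
  from consistent_stepI[OF sys this, of 0] show "consistent_step x u u' d d'"
    by (simp add: xs(1) us_def ds_def)
next
  assume step: "\<forall>x \<in> carrier_vec n. \<forall>u \<in> carrier_vec m. \<forall>u' \<in> carrier_vec m.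
      \<forall>d \<in> carrier_vec r. \<forall>d' \<in> carrier_vec r. consistent_step x u u' d d'"
  show "is_acceptor A B C D E F Ao Bu By Du Dy"
    unfolding is_acceptor_def
  proof (intro allI impI)
    fix x u y d assume sys: "sys_trajectory A B C D E F x u y d"
    \<comment> \<open>The output equation with output \<open>x\<close> leaves no other choice for
      the observer state.\<close>
    define z where "z t = x t - Du *\<^sub>v u t - Dy *\<^sub>v y t" for t
    have car: "x t \<in> carrier_vec n" "u t \<in> carrier_vec m" "y t \<in> carrier_vec p" "d t \<in> carrier_vec r" for t
      using sys unfolding sys_trajectory_def dims by blast+
    have eqs: "y t = C *\<^sub>v x t + D *\<^sub>v u t + F *\<^sub>v d t" "x (Suc t) = A *\<^sub>v x t + B *\<^sub>v u t + E *\<^sub>v d t" for t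
      using sys unfolding sys_trajectory_def by blast+
    have "z (Suc t) = Ao *\<^sub>v z t + Bu *\<^sub>v u t + By *\<^sub>v y t" for t
    proof -
      have "consistent_step (x t) (u t) (u (Suc t)) (d t) (d (Suc t))"
        using step car by blast
      then show ?thesis
        unfolding consistent_step_def Let_def z_def eqs(2)[symmetric] eqs(1)[symmetric] .
    qed
    moreover have "x t = z t + Du *\<^sub>v u t + Dy *\<^sub>v y t" for t
      using car[of t] by (intro eq_vecI) (auto simp: z_def)
    moreover have "z t \<in> carrier_vec n" for t
      by (intro carrier_vecI) (simp add: z_def)
    ultimately have "obs_trajectory Ao Bu By Du Dy x u y z"
      using car unfolding obs_trajectory_def dims by blast
    then show "\<exists>z. obs_trajectory Ao Bu By Du Dy x u y z"
      by blast
  qed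
qed

text \<open>The five matrices are the coefficients of x(t), u(t), u(t+1), d(t) and d(t+1), in this
  order, in the right side minus the left side of the step condition.\<close>

lemma is_acceptor_iff:
  "is_acceptor A B C D E F Ao Bu By Du Dy \<longleftrightarrow>
     Ao - Ao * Dy * C + By * C - A + Dy * C * A = 0\<^sub>m n n \<and>
     Bu + By * D - Ao * Du - Ao * Dy * D - B + Dy * C * B = 0\<^sub>m n m \<and>
     Du + Dy * D = 0\<^sub>m n m \<and>
     By * F - Ao * Dy * F - E + Dy * C * E = 0\<^sub>m n r \<and>
     Dy * F = 0\<^sub>m n r" (is "_ \<longleftrightarrow> ?K1 = _ \<and> ?K2 = _ \<and> ?K3 = _ \<and> ?K4 = _ \<and> ?K5 = _")
proof -
  have "consistent_step x u u' d d' \<longleftrightarrow>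
      ?K1 *\<^sub>v x + ?K2 *\<^sub>v u + ?K3 *\<^sub>v u' + ?K4 *\<^sub>v d + ?K5 *\<^sub>v d' = 0\<^sub>v n"
    if "x \<in> carrier_vec n" "u \<in> carrier_vec m" "u' \<in> carrier_vec m" "d \<in> carrier_vec r" "d' \<in> carrier_vec r"
    for x u u' d d'
  proof -
    have [simp]: "dim_vec x = n" "dim_vec u = m" "dim_vec u' = m" "dim_vec d = r" "dim_vec d' = r"
      using that by auto
    show ?thesis
      \<comment> \<open>After distributing, both sides are sums of entries of iterated matrix-vector
        products. Leaving these entries unexpanded reduces the claim to rearranging sums.\<close>
      by (auto simp: consistent_step_def Let_def vec_eq_iff mat_vec_distrib_dims algebra_simps
          simp del: index_mult_mat_vec)
  qed
  then show ?thesis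
    unfolding is_acceptor_iff_consistent_step
    by (subst sum_mult_vec_eq_zero_iff[symmetric])
      (auto intro!: carrier_matI)
qed

text \<open>Intended for the trajectory \<open>z'\<close> that the acceptor property supplies, whose
  output is the plant state itself. The error is then a difference of two trajectories of one
  observer under the same \<open>u\<close> and \<open>y\<close>, so all driving terms
  cancel.\<close>

lemma observer_error_dynamics:
  assumes "obs_trajectory Ao Bu By Du Dy x u y z'" and "obs_trajectory Ao Bu By Du Dy xh u y z"
  shows "x t - xh t = Ao ^\<^sub>m t *\<^sub>v (z' 0 - z 0)"
proof -
  have car: "z t \<in> carrier_vec n" "z' t \<in> carrier_vec n" "u t \<in> carrier_vec m" "y t \<in> carrier_vec p" for t
    using assms by (auto simp: obs_trajectory_def)
  then have [simp]: "dim_vec (z t) = n" "dim_vec (z' t) = n" "dim_vec (u t) = m" "dim_vec (y t) = p" for t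
    by auto
  have "z' t - z t = Ao ^\<^sub>m t *\<^sub>v (z' 0 - z 0)" for t
  proof (induction t)
    case 0
    then show ?case
      using car by (simp add: one_mult_mat_vec[of _ n])
  next
    case (Suc t)
    have pow: "Ao ^\<^sub>m t \<in> carrier_mat n n"
      using carriers by simp
    have "z' (Suc t) - z (Suc t) = Ao *\<^sub>v (z' t - z t)"
      using assms by (intro eq_vecI) (auto simp: obs_trajectory_def mat_vec_distrib_dims simp del: index_mult_mat_vec)
    also have "\<dots> = (Ao * Ao ^\<^sub>m t) *\<^sub>v (z' 0 - z 0)"
      using pow by (simp add: Suc mat_vec_distrib_dims(5))
    also have "Ao * Ao ^\<^sub>m t = Ao ^\<^sub>m Suc t"
      using pow_mat_Suc_left carriers by blast
    finally show ?case .
  qed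
  moreover have "x t - xh t = z' t - z t"
    using assms by (intro eq_vecI) (auto simp: obs_trajectory_def simp del: index_mult_mat_vec)
  ultimately show ?thesis
    by (rule trans[rotated])
qed

lemma is_uio_iff:
  "is_uio A B C D E F Ao Bu By Du Dy \<longleftrightarrow>
     is_acceptor A B C D E F Ao Bu By Du Dy \<and> schur_stable Ao"
proof (intro iffI conjI)
  assume uio: "is_uio A B C D E F Ao Bu By Du Dy"
  show "is_acceptor A B C D E F Ao Bu By Du Dy"
    using uio by (simp add: is_uio_def)
  have "tends_to_zero (\<lambda>k. Ao ^\<^sub>m k *\<^sub>v v) n" if v: "v \<in> carrier_vec n" for v
  proof -
    \<comment> \<open>With the plant at rest and the observer started at \<open>- v\<close>, the
      error is exactly the power of \<open>Ao\<close> applied to \<open>v\<close>.\<close>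
    let ?z = "\<lambda>t. Ao ^\<^sub>m t *\<^sub>v (- v)"
    have z: "?z t \<in> carrier_vec n" for t
      using carriers by (intro mult_mat_vec_carrier[of _ n n]) (use v in auto)
    have "sys_trajectory A B C D E F (\<lambda>_. 0\<^sub>v n) (\<lambda>_. 0\<^sub>v m) (\<lambda>_. 0\<^sub>v p) (\<lambda>_. 0\<^sub>v r)"
      using carriers by (auto simp: sys_trajectory_def)
    moreover have "obs_trajectory Ao Bu By Du Dy ?z (\<lambda>_. 0\<^sub>v m) (\<lambda>_. 0\<^sub>v p) ?z"
    proof -
      have "?z (Suc t) = Ao *\<^sub>v ?z t" for t
        using pow_mat_Suc_left[of Ao n t, symmetric] carriers v
        by (simp add: mat_vec_distrib_dims(5))
      then show ?thesis
        using carriers z by (auto simp: obs_trajectory_def)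
    qed
    ultimately have "tends_to_zero (\<lambda>t. 0\<^sub>v n - ?z t) n"
      using uio by (fastforce simp: is_uio_def)
    moreover have "0\<^sub>v n - ?z t = Ao ^\<^sub>m t *\<^sub>v v" for t
      using carriers v by (intro eq_vecI) auto
    ultimately show ?thesis by simp
  qed
  then show "schur_stable Ao"
    using schur_stable_iff_pow_mult_vec_tendsto_zero[of Ao n] carriers by blast
next
  assume *: "is_acceptor A B C D E F Ao Bu By Du Dy \<and> schur_stable Ao"
  have "tends_to_zero (\<lambda>t. x t - xh t) n"
    if sys: "sys_trajectory A B C D E F x u y d" and obs: "obs_trajectory Ao Bu By Du Dy xh u y z" for x u y d xh z
  proof -
    obtain z' where z': "obs_trajectory Ao Bu By Du Dy x u y z'"
      using * sys unfolding is_acceptor_def by blast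
    have "z' 0 - z 0 \<in> carrier_vec n"
      using z' obs by (auto simp: obs_trajectory_def)
    then show ?thesis
      unfolding observer_error_dynamics[OF z' obs]
      using * schur_stable_iff_pow_mult_vec_tendsto_zero[OF carriers(7)] by blast
  qed
  then show "is_uio A B C D E F Ao Bu By Du Dy"
    using * unfolding is_uio_def dims by blast
qed

end

section \<open>The acceptor property as the equations of (v), and its link to (iv)\<close>

text \<open>The first four equivalences rearrange the acceptor conditions on the coefficients of
  d(t), x(t), u(t+1) and u(t); the fifth serves the disturbance columns of the pencil equation. The
  terms \<open>- - Y - Y\<close> in the fourth arise from replacing \<open>Ao * Du\<close> by
  \<open>- (Ao * (Dy * D))\<close>.\<close>

lemma mat_linear_equations:
  fixes X Y Z V W :: "real mat"
  assumes "X \<in> carrier_mat a b" "Y \<in> carrier_mat a b" "Z \<in> carrier_mat a b"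
    "V \<in> carrier_mat a b" "W \<in> carrier_mat a b"
  shows "X - Y - Z + V = 0\<^sub>m a b \<longleftrightarrow> - V + (Y - X) = - Z"
    and "V - X + Y - W + Z = 0\<^sub>m a b \<longleftrightarrow> V = W + (- Z + (X - Y))"
    and "Y + X = 0\<^sub>m a b \<longleftrightarrow> Y = - X"
    and "V + X - - Y - Y - W + Z = 0\<^sub>m a b \<longleftrightarrow> V = W - Z + - X"
    and "Z - X + Y = 0\<^sub>m a b \<longleftrightarrow> - X + Y = - Z"
proof -
  note dims [simp] = assms[THEN carrier_matD(1)] assms[THEN carrier_matD(2)]
  have eq: "M = N \<longleftrightarrow> (\<forall>ij \<in> {..<a} \<times> {..<b}. M $$ ij = N $$ ij)"
    if "dim_row M = a" "dim_col M = b" "dim_row N = a" "dim_col N = b" for M N :: "real mat"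
    using that by (auto simp: mat_eq_iff)
  show "X - Y - Z + V = 0\<^sub>m a b \<longleftrightarrow> - V + (Y - X) = - Z"
    by (subst (1 2) eq) (auto intro!: ball_cong)
  show "V - X + Y - W + Z = 0\<^sub>m a b \<longleftrightarrow> V = W + (- Z + (X - Y))"
    by (subst (1 2) eq) (auto intro!: ball_cong)
  show "Y + X = 0\<^sub>m a b \<longleftrightarrow> Y = - X"
    by (subst (1 2) eq) (auto intro!: ball_cong)
  show "V + X - - Y - Y - W + Z = 0\<^sub>m a b \<longleftrightarrow> V = W - Z + - X"
    by (subst (1 2) eq) (auto intro!: ball_cong)
  show "Z - X + Y = 0\<^sub>m a b \<longleftrightarrow> - X + Y = - Z"
    by (subst (1 2) eq) (auto intro!: ball_cong)
qed

context lti_observer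
begin

text \<open>The vanishing products with zero matrices are retained because expanding the block
  products of (v) yields exactly these terms.\<close>

lemma is_acceptor_iff_matrix_equations:
  "is_acceptor A B C D E F Ao Bu By Du Dy \<longleftrightarrow>
     - Dy * (C * E) + (Ao * Dy - By) * F = - E \<and> - Dy * F + (Ao * Dy - By) * 0\<^sub>m p r = 0\<^sub>m n r \<and>
     Ao = A + (- Dy * (C * A) + (Ao * Dy - By) * C) \<and>
     Bu = (1\<^sub>m n - Dy * C) * B + - By * D \<and> Du = 0\<^sub>m n n * B + - Dy * D"
proof -
  have zero: "0\<^sub>m n n * B = 0\<^sub>m n m" "1\<^sub>m n * B = B" "(Ao * Dy - By) * 0\<^sub>m p r = 0\<^sub>m n r"
    by (intro eq_matI; simp)+
  have products: "Dy * (C * E) \<in> carrier_mat n r" "Ao * (Dy * F) \<in> carrier_mat n r" "By * F \<in> carrier_mat n r"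
    "Dy * (C * A) \<in> carrier_mat n n" "Ao * (Dy * C) \<in> carrier_mat n n" "By * C \<in> carrier_mat n n"
    "Dy * (C * B) \<in> carrier_mat n m" "Ao * (Dy * D) \<in> carrier_mat n m" "By * D \<in> carrier_mat n m"
    "Dy * F \<in> carrier_mat n r" "Dy * D \<in> carrier_mat n m"
    by (rule carrier_matI; simp)+
  have "By * F - Ao * Dy * F - E + Dy * C * E = 0\<^sub>m n r \<longleftrightarrow> - Dy * (C * E) + (Ao * Dy - By) * F = - E"
    by (simp add: mat_distrib_dims mat_linear_equations(1)[OF products(3,2) carriers(3) products(1,1)])
  moreover have "Dy * F = 0\<^sub>m n r \<longleftrightarrow> - Dy * F + (Ao * Dy - By) * 0\<^sub>m p r = 0\<^sub>m n r"
    using products(10) by (simp add: zero uminus_mat_eq_zero_iff)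
  moreover have "Ao - Ao * Dy * C + By * C - A + Dy * C * A = 0\<^sub>m n n
      \<longleftrightarrow> Ao = A + (- Dy * (C * A) + (Ao * Dy - By) * C)"
    by (simp add: mat_distrib_dims mat_linear_equations(2)[OF products(5,6,4) carriers(7,1)])
  moreover have Du: "Du + Dy * D = 0\<^sub>m n m \<longleftrightarrow> Du = 0\<^sub>m n n * B + - Dy * D"
    using products(11) by (simp add: zero mat_linear_equations(3)[OF products(11) carriers(10) carriers(10,10,10)])
  \<comment> \<open>The condition on u(t) takes this form only together with the one on u(t+1): if
    \<open>Du = - Dy * D\<close>, the two terms containing \<open>Ao\<close> cancel.\<close>
  moreover have "Bu + By * D - Ao * Du - Ao * Dy * D - B + Dy * C * B = 0\<^sub>m n m
      \<longleftrightarrow> Bu = (1\<^sub>m n - Dy * C) * B + - By * D" if "Du + Dy * D = 0\<^sub>m n m"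
  proof -
    have "Ao * Du = - (Ao * (Dy * D))"
      using that Du products(11) by (simp add: zero)
    then show ?thesis
      by (simp add: mat_distrib_dims zero mat_linear_equations(4)[OF products(9,8,7) carriers(8,2)])
  qed
  ultimately show ?thesis
    unfolding is_acceptor_iff by blast
qed

lemma acceptor_equations_iff:
  "is_acceptor A B C D E F Ao Bu By Du Dy \<longleftrightarrow>
     ((- Dy) @\<^sub>c (Ao * Dy - By)) * four_block_mat (C * E) F F (0\<^sub>m p r) = (- E) @\<^sub>c 0\<^sub>m n r \<and>
     Ao = A + ((- Dy) @\<^sub>c (Ao * Dy - By)) * ((C * A) @\<^sub>r C) \<and>
     Bu @\<^sub>r Du = four_block_mat (1\<^sub>m n - Dy * C) (- By) (0\<^sub>m n n) (- Dy) * (B @\<^sub>r D)"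
proof -
  have car: "- Dy \<in> carrier_mat n p" "Ao * Dy - By \<in> carrier_mat n p"
    "C * A \<in> carrier_mat p n" "C * E \<in> carrier_mat p r"
    by (rule carrier_matI; simp)+
  note append_mult = append_cols_mult_append_rows[OF car(1,2)]
  have "((- Dy) @\<^sub>c (Ao * Dy - By)) * four_block_mat (C * E) F F (0\<^sub>m p r) = (- E) @\<^sub>c 0\<^sub>m n r
      \<longleftrightarrow> - Dy * (C * E) + (Ao * Dy - By) * F = - E \<and> - Dy * F + (Ao * Dy - By) * 0\<^sub>m p r = 0\<^sub>m n r"
  proof -
    have product: "((- Dy) @\<^sub>c (Ao * Dy - By)) * four_block_mat (C * E) F F (0\<^sub>m p r)
        = (- Dy * (C * E) + (Ao * Dy - By) * F) @\<^sub>c (- Dy * F + (Ao * Dy - By) * 0\<^sub>m p r)"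
      unfolding four_block_mat_eq_append(1)[OF car(4) carriers(6,6) zero_carrier_mat]
        mult_append_cols[OF append_cols_carrier[OF car(1,2)] carrier_append_rows[OF car(4) carriers(6)]
          carrier_append_rows[OF carriers(6) zero_carrier_mat]]
        append_mult[OF car(4) carriers(6)] append_mult[OF carriers(6) zero_carrier_mat] ..
    have car: "- Dy * (C * E) + (Ao * Dy - By) * F \<in> carrier_mat n r"
      "- Dy * F + (Ao * Dy - By) * 0\<^sub>m p r \<in> carrier_mat n r" "- E \<in> carrier_mat n r"
      by (rule carrier_matI; simp)+
    show ?thesis
      unfolding product by (rule append_cols_eq_iff[OF car(1,3,2) zero_carrier_mat])
  qed
  moreover have "((- Dy) @\<^sub>c (Ao * Dy - By)) * ((C * A) @\<^sub>r C) = - Dy * (C * A) + (Ao * Dy - By) * C"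
    by (rule append_mult[OF car(3) carriers(4)])
  moreover have "Bu @\<^sub>r Du = four_block_mat (1\<^sub>m n - Dy * C) (- By) (0\<^sub>m n n) (- Dy) * (B @\<^sub>r D)
      \<longleftrightarrow> Bu = (1\<^sub>m n - Dy * C) * B + - By * D \<and> Du = 0\<^sub>m n n * B + - Dy * D"
  proof -
    have blocks: "1\<^sub>m n - Dy * C \<in> carrier_mat n n" "- By \<in> carrier_mat n p" "0\<^sub>m n n \<in> carrier_mat n n"
        "- Dy \<in> carrier_mat n p"
      by (rule carrier_matI; simp)+
    have product: "four_block_mat (1\<^sub>m n - Dy * C) (- By) (0\<^sub>m n n) (- Dy) * (B @\<^sub>r D)
        = ((1\<^sub>m n - Dy * C) * B + - By * D) @\<^sub>r (0\<^sub>m n n * B + - Dy * D)"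
      unfolding four_block_mat_eq_append(2)[OF blocks]
        append_rows_mult[OF carrier_append_rows[OF carriers(2,5)] append_cols_carrier[OF blocks(1,2)]
          append_cols_carrier[OF blocks(3,4)]]
        append_cols_mult_append_rows[OF blocks(1,2) carriers(2,5)]
        append_cols_mult_append_rows[OF blocks(3,4) carriers(2,5)] ..
    have car: "(1\<^sub>m n - Dy * C) * B + - By * D \<in> carrier_mat n m" "0\<^sub>m n n * B + - Dy * D \<in> carrier_mat n m"
      by (rule carrier_matI; simp)+
    show ?thesis
      unfolding product by (rule append_rows_eq_iff[OF carriers(8) car(1) carriers(10) car(2)])
  qed
  ultimately show ?thesis
    by (simp only: is_acceptor_iff_matrix_equations conj_assoc)
qed

end

context lti_observer
begin

lemma is_uio_iff_matrix_equations:
  "is_uio A B C D E F Ao Bu By Du Dy \<longleftrightarrow> schur_stable Ao \<and>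
     ((- Dy) @\<^sub>c (Ao * Dy - By)) * four_block_mat (C * E) F F (0\<^sub>m p r) = (- E) @\<^sub>c 0\<^sub>m n r \<and>
     Ao = A + ((- Dy) @\<^sub>c (Ao * Dy - By)) * ((C * A) @\<^sub>r C) \<and>
     Bu @\<^sub>r Du = four_block_mat (1\<^sub>m n - Dy * C) (- By) (0\<^sub>m n n) (- Dy) * (B @\<^sub>r D)"
  unfolding is_uio_iff acceptor_equations_iff by blast

text \<open>For fixed \<open>Ao\<close>, the substitution is a bijection between the pairs
  (\<open>By\<close>, \<open>Dy\<close>) and (\<open>Q0\<close>, \<open>Q1\<close>). Since
  \<open>Bu\<close> and \<open>Du\<close> are chosen so that the input conditions hold, the acceptor
  property reduces to three equations, and these are what remains of the coefficient equations once
  \<open>P0\<close> and \<open>P1\<close> have their forced values.\<close>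

lemma pencil_equation_iff:
  assumes P: "P0 \<in> carrier_mat n n" "P1 \<in> carrier_mat n n"
    and Q: "Ao * Dy - By = Q0" "- Dy = Q1"
    and u: "Bu = (1\<^sub>m n - Dy * C) * B + - By * D" "Du = 0\<^sub>m n n * B + - Dy * D"
  shows "pencil (P0 @\<^sub>c Q0) (P1 @\<^sub>c Q1) *
      four_block_mat (char_poly_matrix A) (- const_pmat E) (- const_pmat C) (- const_pmat F)
      = char_poly_matrix Ao @\<^sub>c 0\<^sub>m n r
    \<longleftrightarrow> P0 = 1\<^sub>m n - Dy * C \<and> P1 = 0\<^sub>m n n \<and> is_acceptor A B C D E F Ao Bu By Du Dy"
proof -
  have Qc: "Q0 \<in> carrier_mat n p" "Q1 \<in> carrier_mat n p"
    unfolding Q[symmetric] by (rule carrier_matI; simp)+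
  have P0: "1\<^sub>m n + Q1 * C = 1\<^sub>m n - Dy * C"
    unfolding Q[symmetric] by (intro eq_matI) simp_all
  have "(1\<^sub>m n - Dy * C) * A + Q0 * C = A + (- Dy * (C * A) + Q0 * C)"
    using Qc by (intro eq_matI) (simp_all add: mat_distrib_dims left_mult_one_mat[OF carriers(1)] del: index_mult_mat(1))
  moreover have "(1\<^sub>m n - Dy * C) * E + Q0 * F = 0\<^sub>m n r \<longleftrightarrow> - Dy * (C * E) + Q0 * F = - E"
  proof -
    have "E - Dy * (C * E) + Q0 * F = 0\<^sub>m n r \<longleftrightarrow> - (Dy * (C * E)) + Q0 * F = - E"
      using mat_linear_equations(5)[of "Dy * (C * E)" n r "Q0 * F" E E E] carriers(3) Qc
      by (metis carrier_matI dims(1-22) index_mult_mat(2,3) carrier_matD)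
    then show ?thesis
      by (simp add: mat_distrib_dims left_mult_one_mat[OF carriers(3)])
  qed
  moreover have "0\<^sub>m n n * E + Q1 * F = - Dy * F + Q0 * 0\<^sub>m p r"
    using Qc unfolding Q(2)[symmetric] by (intro eq_matI) simp_all
  ultimately show ?thesis
    unfolding pencil_mult_disturbance_columns[OF append_cols_carrier[OF P(1) Qc(1)] append_cols_carrier[OF P(2) Qc(2)]
        carriers(1,4,7,3,6)]
      pencil_mult_state_columns[OF P Qc carriers(1,4,7)] P0
      append_cols_mult_append_rows[OF P(1) Qc(1) carriers(3,6)]
      append_cols_mult_append_rows[OF P(2) Qc(2) carriers(3,6)]
      is_acceptor_iff_matrix_equations Q(1)
    using u by auto
qed

end

section \<open>Equivalence of the five statements\<close>

text \<open>(i), (iii), (iv) and (v) are linked by equivalences, while (ii) is squeezed between (iv)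
  and (iii), so that one implication on each side suffices.\<close>

lemma all_equivalentI:
  assumes "P1 \<longleftrightarrow> P5" "P4 \<longleftrightarrow> P5" "P3 \<longleftrightarrow> P4" "P2 \<Longrightarrow> P3" "P4 \<Longrightarrow> P2"
  shows "all_equivalent [P1, P2, P3, P4, P5]"
  using assms by (auto simp: all_equivalent_def)

theorem theorem7:
  fixes A B C D E F M_E M_F :: "real mat" and n m p r :: nat
  assumes "A \<in> carrier_mat n n" and "B \<in> carrier_mat n m" and "E \<in> carrier_mat n r"
    and "C \<in> carrier_mat p n" and "D \<in> carrier_mat p m" and "F \<in> carrier_mat p r"
    and "vec_space.rank (n + p) (E @\<^sub>r F) = r"
    and "M_E \<in> carrier_mat (n + p - r) n" and "M_F \<in> carrier_mat (n + p - r) p"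
    and "vec_space.rank (n + p - r) (M_E @\<^sub>c M_F) = n + p - r"
    and "mat_kernel (M_E @\<^sub>c M_F) = {(E @\<^sub>r F) *\<^sub>v w | w. w \<in> carrier_vec r}"
  shows "all_equivalent [
    \<comment> \<open>(i)\<close>
    (\<exists>Ao \<in> carrier_mat n n. \<exists>Bu \<in> carrier_mat n m. \<exists>By \<in> carrier_mat n p.
     \<exists>Du \<in> carrier_mat n m. \<exists>Dy \<in> carrier_mat n p.
       is_uio A B C D E F Ao Bu By Du Dy),
    \<comment> \<open>(ii)\<close>
    (\<exists>T0 \<in> carrier_mat n (n + p - r). \<exists>T1 \<in> carrier_mat n (n + p - r).
     \<exists>Ao \<in> carrier_mat n n. \<exists>Bu \<in> carrier_mat n m. \<exists>By \<in> carrier_mat n p.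
     \<exists>Du \<in> carrier_mat n m. \<exists>Dy \<in> carrier_mat n p.
       schur_stable Ao \<and>
       char_poly_matrix Ao @\<^sub>c
         (- const_pmat Bu - char_poly_matrix Ao * const_pmat Du) @\<^sub>c
         (- const_pmat By - char_poly_matrix Ao * const_pmat Dy)
       = pencil T0 T1 * const_pmat (M_E @\<^sub>c M_F) *
         ((char_poly_matrix A @\<^sub>c (- const_pmat B) @\<^sub>c 0\<^sub>m n p) @\<^sub>r
          ((- const_pmat C) @\<^sub>c (- const_pmat D) @\<^sub>c 1\<^sub>m p))),
    \<comment> \<open>(iii)\<close>
    (\<exists>T0 \<in> carrier_mat n (n + p - r). \<exists>T1 \<in> carrier_mat n (n + p - r).
     \<exists>Ao \<in> carrier_mat n n.
       schur_stable Ao \<and>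
       pencil T0 T1 * const_pmat (M_E @\<^sub>c M_F) * (char_poly_matrix A @\<^sub>r (- const_pmat C))
       = char_poly_matrix Ao),
    \<comment> \<open>(iv)\<close>
    (\<exists>S0 \<in> carrier_mat n (n + p). \<exists>S1 \<in> carrier_mat n (n + p).
     \<exists>Ao \<in> carrier_mat n n.
       schur_stable Ao \<and>
       pencil S0 S1 *
         four_block_mat (char_poly_matrix A) (- const_pmat E) (- const_pmat C) (- const_pmat F)
       = char_poly_matrix Ao @\<^sub>c 0\<^sub>m n r),
    \<comment> \<open>(v)\<close>
    (\<exists>Ao \<in> carrier_mat n n. \<exists>Bu \<in> carrier_mat n m. \<exists>By \<in> carrier_mat n p.
     \<exists>Du \<in> carrier_mat n m. \<exists>Dy \<in> carrier_mat n p.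
       schur_stable Ao \<and>
       ((- Dy) @\<^sub>c (Ao * Dy - By)) * four_block_mat (C * E) F F (0\<^sub>m p r)
         = (- E) @\<^sub>c 0\<^sub>m n r \<and>
       Ao = A + ((- Dy) @\<^sub>c (Ao * Dy - By)) * ((C * A) @\<^sub>r C) \<and>
       Bu @\<^sub>r Du = four_block_mat (1\<^sub>m n - Dy * C) (- By) (0\<^sub>m n n) (- Dy) * (B @\<^sub>r D))]"
proof -
  let ?M = "M_E @\<^sub>c M_F" and ?N = "E @\<^sub>r F" and ?q = "n + p - r"
  note sys = assms(1-6)
  have M: "?M \<in> carrier_mat ?q (n + p)"
    using assms(8,9) by simp
  have N: "?N \<in> carrier_mat (n + p) r"
    using assms(3,6) by auto
  have MN: "?M * ?N = 0\<^sub>m ?q r"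
    by (rule mult_eq_zero_of_kernel[OF M N]) (simp add: assms(11))
  have kill: "T * ?M * ?N = 0\<^sub>m n r" if "T \<in> carrier_mat n ?q" for T
    using that M N by (simp add: assoc_mult_mat[OF that M N] MN)
  have factor: "\<exists>T \<in> carrier_mat n ?q. S = T * ?M" if "S \<in> carrier_mat n (n + p)" "S * ?N = 0\<^sub>m n r" for S
    using mult_eq_zero_imp_factor[OF M N that(1) assms(10) _ that(2)] assms(11) by blast
  have pencil_M: "pencil T0 T1 * const_pmat ?M = pencil (T0 * ?M) (T1 * ?M)"
    if "T0 \<in> carrier_mat n ?q" "T1 \<in> carrier_mat n ?q" for T0 T1
    by (rule pencil_mult_const[OF that M])
  have TM: "T * ?M \<in> carrier_mat n (n + p)" if "T \<in> carrier_mat n ?q" for T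
    using that M by simp
  have iv_iff: "pencil S0 S1 *
         four_block_mat (char_poly_matrix A) (- const_pmat E) (- const_pmat C) (- const_pmat F)
       = char_poly_matrix Ao @\<^sub>c 0\<^sub>m n r \<longleftrightarrow>
      pencil S0 S1 * (char_poly_matrix A @\<^sub>r (- const_pmat C)) = char_poly_matrix Ao \<and>
      S0 * ?N = 0\<^sub>m n r \<and> S1 * ?N = 0\<^sub>m n r"
    if "S0 \<in> carrier_mat n (n + p)" "S1 \<in> carrier_mat n (n + p)" "Ao \<in> carrier_mat n n" for S0 S1 Ao
    by (rule pencil_mult_disturbance_columns[OF that(1,2) assms(1,4) that(3) assms(3,6)])
  show ?thesis
  proof (rule all_equivalentI, goal_cases)
    case 1
    have "is_uio A B C D E F Ao Bu By Du Dy \<longleftrightarrow> schur_stable Ao \<and>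
       ((- Dy) @\<^sub>c (Ao * Dy - By)) * four_block_mat (C * E) F F (0\<^sub>m p r) = (- E) @\<^sub>c 0\<^sub>m n r \<and>
       Ao = A + ((- Dy) @\<^sub>c (Ao * Dy - By)) * ((C * A) @\<^sub>r C) \<and>
       Bu @\<^sub>r Du = four_block_mat (1\<^sub>m n - Dy * C) (- By) (0\<^sub>m n n) (- Dy) * (B @\<^sub>r D)"
      if "Ao \<in> carrier_mat n n" "Bu \<in> carrier_mat n m" "By \<in> carrier_mat n p"
        "Du \<in> carrier_mat n m" "Dy \<in> carrier_mat n p" for Ao Bu By Du Dy
    proof -
      interpret lti_observer A B C D E F Ao Bu By Du Dy n m p r
        by unfold_locales (fact sys that)+
      show ?thesis
        by (rule is_uio_iff_matrix_equations)
    qed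
    then show ?case
      by (intro bex_cong refl)
  next
    case 2
    show ?case
    proof (intro iffI; elim bexE conjE)
      fix S0 S1 Ao
      assume S: "S0 \<in> carrier_mat n (n + p)" "S1 \<in> carrier_mat n (n + p)" and Ao: "Ao \<in> carrier_mat n n"
        and stable: "schur_stable Ao"
        and eq: "pencil S0 S1 *
         four_block_mat (char_poly_matrix A) (- const_pmat E) (- const_pmat C) (- const_pmat F)
       = char_poly_matrix Ao @\<^sub>c 0\<^sub>m n r"
      obtain P0 Q0 where P0: "P0 \<in> carrier_mat n n" "Q0 \<in> carrier_mat n p" "S0 = P0 @\<^sub>c Q0"
        using split_append_cols[OF S(1)] .
      obtain P1 Q1 where P1: "P1 \<in> carrier_mat n n" "Q1 \<in> carrier_mat n p" "S1 = P1 @\<^sub>c Q1"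
        using split_append_cols[OF S(2)] .
      define Dy where "Dy = - Q1"
      define By where "By = Ao * Dy - Q0"
      \<comment> \<open>The known input does not occur in (iv). Defining \<open>Bu\<close> and
        \<open>Du\<close> by the last equation of (v) makes that equation true by
        construction.\<close>
      define Bu where "Bu = (1\<^sub>m n - Dy * C) * B + - By * D"
      define Du where "Du = 0\<^sub>m n n * B + - Dy * D"
      have Dy: "Dy \<in> carrier_mat n p"
        using P1 by (simp add: Dy_def)
      have By: "By \<in> carrier_mat n p"
        using P0 unfolding By_def by (intro minus_carrier_mat)
      have Bu: "Bu \<in> carrier_mat n m" and Du: "Du \<in> carrier_mat n m"
        using Dy By assms(2,5) unfolding Bu_def Du_def by (auto intro!: carrier_matI)
      interpret lti_observer A B C D E F Ao Bu By Du Dy n m p r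
        by unfold_locales (fact sys Ao Bu By Du Dy)+
      have Q: "Ao * Dy - By = Q0" "- Dy = Q1"
        using P0 Dy Ao by (auto simp: By_def Dy_def intro!: eq_matI)
      have "is_acceptor A B C D E F Ao Bu By Du Dy"
        using eq unfolding P0(3) P1(3) pencil_equation_iff[OF P0(1) P1(1) Q Bu_def Du_def] by blast
      then show "\<exists>Ao \<in> carrier_mat n n. \<exists>Bu \<in> carrier_mat n m. \<exists>By \<in> carrier_mat n p.
        \<exists>Du \<in> carrier_mat n m. \<exists>Dy \<in> carrier_mat n p. schur_stable Ao \<and>
         ((- Dy) @\<^sub>c (Ao * Dy - By)) * four_block_mat (C * E) F F (0\<^sub>m p r) = (- E) @\<^sub>c 0\<^sub>m n r \<and>
         Ao = A + ((- Dy) @\<^sub>c (Ao * Dy - By)) * ((C * A) @\<^sub>r C) \<and>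
         Bu @\<^sub>r Du = four_block_mat (1\<^sub>m n - Dy * C) (- By) (0\<^sub>m n n) (- Dy) * (B @\<^sub>r D)"
        using Ao Bu By Du Dy stable acceptor_equations_iff by blast
    next
      fix Ao Bu By Du Dy
      assume car: "Ao \<in> carrier_mat n n" "Bu \<in> carrier_mat n m" "By \<in> carrier_mat n p"
        "Du \<in> carrier_mat n m" "Dy \<in> carrier_mat n p"
        and stable: "schur_stable Ao"
        and eqs: "((- Dy) @\<^sub>c (Ao * Dy - By)) * four_block_mat (C * E) F F (0\<^sub>m p r) = (- E) @\<^sub>c 0\<^sub>m n r"
        "Ao = A + ((- Dy) @\<^sub>c (Ao * Dy - By)) * ((C * A) @\<^sub>r C)"
        "Bu @\<^sub>r Du = four_block_mat (1\<^sub>m n - Dy * C) (- By) (0\<^sub>m n n) (- Dy) * (B @\<^sub>r D)"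
      interpret lti_observer A B C D E F Ao Bu By Du Dy n m p r
        by unfold_locales (fact sys car)+
      have acc: "is_acceptor A B C D E F Ao Bu By Du Dy"
        using eqs acceptor_equations_iff by blast
      then have u: "Bu = (1\<^sub>m n - Dy * C) * B + - By * D" "Du = 0\<^sub>m n n * B + - Dy * D"
        using is_acceptor_iff_matrix_equations by blast+
      have P: "1\<^sub>m n - Dy * C \<in> carrier_mat n n" "Ao * Dy - By \<in> carrier_mat n p" "- Dy \<in> carrier_mat n p"
        by (rule carrier_matI; simp)+
      \<comment> \<open>With \<open>Q0 = Ao * Dy - By\<close> and \<open>Q1 = - Dy\<close>, the
        remaining blocks are forced: \<open>P0 = I + Q1 * C\<close> and
        \<open>P1 = 0\<close>.\<close>
      have "pencil ((1\<^sub>m n - Dy * C) @\<^sub>c (Ao * Dy - By)) (0\<^sub>m n n @\<^sub>c - Dy) *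
          four_block_mat (char_poly_matrix A) (- const_pmat E) (- const_pmat C) (- const_pmat F)
          = char_poly_matrix Ao @\<^sub>c 0\<^sub>m n r"
        using pencil_equation_iff[OF P(1) zero_carrier_mat refl refl u] acc by blast
      then show "\<exists>S0 \<in> carrier_mat n (n + p). \<exists>S1 \<in> carrier_mat n (n + p). \<exists>Ao \<in> carrier_mat n n.
         schur_stable Ao \<and> pencil S0 S1 *
         four_block_mat (char_poly_matrix A) (- const_pmat E) (- const_pmat C) (- const_pmat F)
         = char_poly_matrix Ao @\<^sub>c 0\<^sub>m n r"
        using append_cols_carrier[OF P(1,2)] append_cols_carrier[OF zero_carrier_mat P(3)] car(1) stable
        by blast
    qed
  next
    case 3
    show ?case
    proof (intro iffI; elim bexE conjE)
      fix T0 T1 Ao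
      assume T: "T0 \<in> carrier_mat n ?q" "T1 \<in> carrier_mat n ?q" and Ao: "Ao \<in> carrier_mat n n"
        and stable: "schur_stable Ao"
        and "pencil T0 T1 * const_pmat ?M * (char_poly_matrix A @\<^sub>r (- const_pmat C)) = char_poly_matrix Ao"
      then have "pencil (T0 * ?M) (T1 * ?M) *
          four_block_mat (char_poly_matrix A) (- const_pmat E) (- const_pmat C) (- const_pmat F)
          = char_poly_matrix Ao @\<^sub>c 0\<^sub>m n r"
        unfolding iv_iff[OF TM[OF T(1)] TM[OF T(2)] Ao] using kill T pencil_M[OF T] by simp
      then show "\<exists>S0 \<in> carrier_mat n (n + p). \<exists>S1 \<in> carrier_mat n (n + p). \<exists>Ao \<in> carrier_mat n n.
         schur_stable Ao \<and> pencil S0 S1 *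
         four_block_mat (char_poly_matrix A) (- const_pmat E) (- const_pmat C) (- const_pmat F)
         = char_poly_matrix Ao @\<^sub>c 0\<^sub>m n r"
        using TM[OF T(1)] TM[OF T(2)] Ao stable by blast
    next
      fix S0 S1 Ao
      assume S: "S0 \<in> carrier_mat n (n + p)" "S1 \<in> carrier_mat n (n + p)" and Ao: "Ao \<in> carrier_mat n n"
        and stable: "schur_stable Ao"
        and eq: "pencil S0 S1 *
         four_block_mat (char_poly_matrix A) (- const_pmat E) (- const_pmat C) (- const_pmat F)
       = char_poly_matrix Ao @\<^sub>c 0\<^sub>m n r"
      note eqs = eq[unfolded iv_iff[OF S Ao]]
      \<comment> \<open>Each coefficient of S(z) annihilates \<open>[E; F]\<close> by itself, so the
        factorisation is done coefficient by coefficient and T(z) again has degree at most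
        one.\<close>
      obtain T0 T1 where T: "T0 \<in> carrier_mat n ?q" "S0 = T0 * ?M" "T1 \<in> carrier_mat n ?q" "S1 = T1 * ?M"
        using factor[OF S(1)] factor[OF S(2)] eqs by blast
      have "pencil T0 T1 * const_pmat ?M * (char_poly_matrix A @\<^sub>r (- const_pmat C)) = char_poly_matrix Ao"
        using eqs unfolding pencil_M[OF T(1,3)] T(2,4) by (rule conjunct1)
      then show "\<exists>T0 \<in> carrier_mat n ?q. \<exists>T1 \<in> carrier_mat n ?q. \<exists>Ao \<in> carrier_mat n n.
         schur_stable Ao \<and>
         pencil T0 T1 * const_pmat ?M * (char_poly_matrix A @\<^sub>r (- const_pmat C)) = char_poly_matrix Ao"
        by (intro bexI[OF _ T(1)] bexI[OF _ T(3)] bexI[OF _ Ao] conjI stable)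
    qed
  next
    case 4
    then obtain T0 T1 Ao Bu By Du Dy where T: "T0 \<in> carrier_mat n ?q" "T1 \<in> carrier_mat n ?q"
      and car: "Ao \<in> carrier_mat n n" "Bu \<in> carrier_mat n m" "By \<in> carrier_mat n p"
        "Du \<in> carrier_mat n m" "Dy \<in> carrier_mat n p"
      and stable: "schur_stable Ao"
      and eq: "char_poly_matrix Ao @\<^sub>c
         (- const_pmat Bu - char_poly_matrix Ao * const_pmat Du) @\<^sub>c
         (- const_pmat By - char_poly_matrix Ao * const_pmat Dy)
       = pencil T0 T1 * const_pmat ?M *
         ((char_poly_matrix A @\<^sub>c (- const_pmat B) @\<^sub>c 0\<^sub>m n p) @\<^sub>r
          ((- const_pmat C) @\<^sub>c (- const_pmat D) @\<^sub>c 1\<^sub>m p))"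
      by blast
    have "pencil T0 T1 * const_pmat ?M * (char_poly_matrix A @\<^sub>r (- const_pmat C)) = char_poly_matrix Ao"
      using eq
      unfolding pencil_M[OF T] observer_pencil_iff[OF TM[OF T(1)] TM[OF T(2)] assms(1,4) car(1) assms(2,5) car(2-5)]
      by (elim conjE sym)
    then show ?case
      by (intro bexI[OF _ T(1)] bexI[OF _ T(2)] bexI[OF _ car(1)] conjI stable)
  next
    case 5
    then obtain S0 S1 Ao where S: "S0 \<in> carrier_mat n (n + p)" "S1 \<in> carrier_mat n (n + p)"
      and Ao: "Ao \<in> carrier_mat n n" and stable: "schur_stable Ao"
      and eq: "pencil S0 S1 *
         four_block_mat (char_poly_matrix A) (- const_pmat E) (- const_pmat C) (- const_pmat F)
       = char_poly_matrix Ao @\<^sub>c 0\<^sub>m n r"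
      by blast
    note eqs = eq[unfolded iv_iff[OF S Ao]]
    obtain T0 T1 where T: "T0 \<in> carrier_mat n ?q" "S0 = T0 * ?M" "T1 \<in> carrier_mat n ?q" "S1 = T1 * ?M"
      using factor[OF S(1)] factor[OF S(2)] eqs by blast
    \<comment> \<open>Multiplication by \<open>[0; I]\<close> extracts the last \<open>p\<close>
      columns of \<open>S0\<close> and \<open>S1\<close>, so \<open>Dy\<close> and \<open>By\<close>
      agree with the substitution that leads from (iv) to (v). \<open>Du\<close> and
      \<open>Bu\<close> solve the coefficient equations of the input columns,
      \<open>- Du = - S1 [B; D]\<close> and \<open>Ao * Du - Bu = - S0 [B; D]\<close>.\<close>
    define Dy where "Dy = - (S1 * (0\<^sub>m n p @\<^sub>r 1\<^sub>m p))"
    define By where "By = Ao * Dy - S0 * (0\<^sub>m n p @\<^sub>r 1\<^sub>m p)"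
    define Du where "Du = S1 * (B @\<^sub>r D)"
    define Bu where "Bu = Ao * Du + S0 * (B @\<^sub>r D)"
    have blocks: "(0\<^sub>m n p @\<^sub>r 1\<^sub>m p :: real mat) \<in> carrier_mat (n + p) p" "B @\<^sub>r D \<in> carrier_mat (n + p) m"
      using assms(2,5) by auto
    have Dy: "Dy \<in> carrier_mat n p" and Du: "Du \<in> carrier_mat n m"
      using S blocks by (simp_all add: Dy_def Du_def)
    have By: "By \<in> carrier_mat n p"
      unfolding By_def by (intro minus_carrier_mat mult_carrier_mat[OF S(1) blocks(1)])
    have Bu: "Bu \<in> carrier_mat n m"
      unfolding Bu_def by (intro add_carrier_mat mult_carrier_mat[OF S(1) blocks(2)])
    have "- const_pmat Bu - char_poly_matrix Ao * const_pmat Du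
        = pencil S0 S1 * (- const_pmat B @\<^sub>r - const_pmat D)"
    proof -
      have "Ao * Du - Bu = - (S0 * (B @\<^sub>r D))"
        using Bu Ao Du S blocks by (intro eq_matI) (simp_all add: Bu_def del: index_mult_mat(1))
      then show ?thesis
        unfolding char_poly_matrix_affine_eq_pencil[OF Ao Bu Du] pencil_mult_const_columns[OF S assms(2,5)]
        by (simp add: Du_def)
    qed
    moreover have "- const_pmat By - char_poly_matrix Ao * const_pmat Dy = pencil S0 S1 * (0\<^sub>m n p @\<^sub>r 1\<^sub>m p)"
    proof -
      have "(0\<^sub>m n p @\<^sub>r 1\<^sub>m p) = const_pmat (0\<^sub>m n p @\<^sub>r 1\<^sub>m p)"
        by (intro eq_matI) (auto simp: const_pmat_def append_rows_def)
      moreover have "Ao * Dy - By = S0 * (0\<^sub>m n p @\<^sub>r 1\<^sub>m p)"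
        using By Ao Dy S blocks by (intro eq_matI) (simp_all add: By_def del: index_mult_mat(1))
      ultimately show ?thesis
        unfolding char_poly_matrix_affine_eq_pencil[OF Ao By Dy]
        by (simp add: pencil_mult_const[OF S blocks(1)] Dy_def)
    qed
    ultimately have "char_poly_matrix Ao @\<^sub>c
         (- const_pmat Bu - char_poly_matrix Ao * const_pmat Du) @\<^sub>c
         (- const_pmat By - char_poly_matrix Ao * const_pmat Dy)
       = pencil S0 S1 *
         ((char_poly_matrix A @\<^sub>c (- const_pmat B) @\<^sub>c 0\<^sub>m n p) @\<^sub>r
          ((- const_pmat C) @\<^sub>c (- const_pmat D) @\<^sub>c 1\<^sub>m p))"
      unfolding observer_pencil_iff[OF S assms(1,4) Ao assms(2,5) Bu By Du Dy] using eqs by simp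
    then have "char_poly_matrix Ao @\<^sub>c
         (- const_pmat Bu - char_poly_matrix Ao * const_pmat Du) @\<^sub>c
         (- const_pmat By - char_poly_matrix Ao * const_pmat Dy)
       = pencil T0 T1 * const_pmat ?M *
         ((char_poly_matrix A @\<^sub>c (- const_pmat B) @\<^sub>c 0\<^sub>m n p) @\<^sub>r
          ((- const_pmat C) @\<^sub>c (- const_pmat D) @\<^sub>c 1\<^sub>m p))"
      unfolding pencil_M[OF T(1,3)] T(2,4) .
    then show ?case
      by (intro bexI[OF _ T(1)] bexI[OF _ T(3)] bexI[OF _ Ao] bexI[OF _ Bu] bexI[OF _ By]
          bexI[OF _ Du] bexI[OF _ Dy] conjI stable)
  qed
qed

end
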